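(* Let $(T_n)_{n\ge1}$ be a positively divergent perturbed random walk. (a) If $\xi\ge0$ a.s., then for each $a>0$ and $x\in\mathbb{R}$ the assertions (1) $\mathbb{E}\exp(aN(x))<\infty$, (2) $e^{a}\,\mathbb{P}\{\xi=0,\eta\le x\}+\mathbb{P}\{\xi=0,\eta>x\}<1$ are equivalent. As a consequence, for any $x\in\mathbb{R}$, $$\{a>0:\mathbb{E}e^{aN(x)}<\infty\}=(0,a(x)),$$ where $a(x)\in(0,\infty]$ equals the supremum of all positive $a$ satisfying (2). As a function of $x$, $a(x)$ is nonincreasing with lower bound $-\log\mathbb{P}\{\xi=0\}$. (b) If $\xi>0$ a.s., then $a(x)=\infty$ for all $x\in\mathbb{R}$, and thus $\mathbb{E}e^{aN(x)}<\infty$ for any $a>0$ and $x\in\mathbb{R}$. (c) If $\mathbb{P}\{\xi<0\}>0$, then for each $a>0$ the following assertions are equivalent: (3) $\mathbb{E}\exp(aN(x))<\infty$ for some/all $x\in\mathbb{R}$; (4) $\mathbb{E}\exp(aN^*(x))<\infty$ for some/all $x\in\mathbb{R}$; (5) $R:=-\log\inf_{t\ge0}\mathbb{E}e^{-t\xi}\ge a$.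
   Context: Let $(\xi,\eta),(\xi_1,\eta_1),(\xi_2,\eta_2),\ldots$ be i.i.d. $\mathbb{R}^2$-valued random vectors; no condition is imposed on the dependence between $\xi$ and $\eta$. Put $S_0:=0$, $S_n:=\xi_1+\cdots+\xi_n$ for $n\in\mathbb{N}=\{1,2,\ldots\}$, and $T_n:=S_{n-1}+\eta_n$ for $n\in\mathbb{N}$; $(T_n)_{n\ge1}$ is called a perturbed random walk. Standing assumption: $\mathbb{P}\{\xi=0\}<1$ and $\mathbb{P}\{\eta=0\}<1$. The perturbed random walk is called positively divergent if $\lim_{n\to\infty}T_n=\infty$ a.s. For $x\in\mathbb{R}$, $N(x):=\#\{n\in\mathbb{N}:T_n\le x\}$ and $N^*(x):=\#\{n\in\mathbb{N}_0:S_n\le x\}$, where $\mathbb{N}_0=\{0,1,2,\ldots\}$. Convention: $-\log 0:=\infty$. An assertion "for some/all $x$" in a list of equivalent assertions means that both the version with "for some $x$" and the version with "for all $x$" belong to the list of equivalent assertions. *)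

theory Defs
  imports "HOL-Probability.Probability"
begin

text \<open>The sequence is indexed by \<open>{0, 1, 2, \<dots>}\<close>: the pair with index 0 is the generic
  copy \<open>(\<xi>, \<eta>)\<close>, and only the pairs with index at least 1 enter the walks.\<close>

locale perturbed_random_walk = prob_space M for M :: "'a measure" +
  fixes \<xi> \<eta> :: "nat \<Rightarrow> 'a \<Rightarrow> real"
  assumes indep_pairs: "indep_vars (\<lambda>_. borel) (\<lambda>n \<omega>. (\<xi> n \<omega>, \<eta> n \<omega>)) UNIV"
    and ident_pairs: "\<And>n. distr M borel (\<lambda>\<omega>. (\<xi> n \<omega>, \<eta> n \<omega>)) = distr M borel (\<lambda>\<omega>. (\<xi> 0 \<omega>, \<eta> 0 \<omega>))"
    and xi_nondegenerate: "prob {\<omega> \<in> space M. \<xi> 0 \<omega> = 0} < 1"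
    and eta_nondegenerate: "prob {\<omega> \<in> space M. \<eta> 0 \<omega> = 0} < 1"

definition walk :: "(nat \<Rightarrow> 'a \<Rightarrow> real) \<Rightarrow> nat \<Rightarrow> 'a \<Rightarrow> real" where
  "walk \<xi> n \<omega> = (\<Sum>i=1..n. \<xi> i \<omega>)"

text \<open>Only the values at \<open>n \<ge> 1\<close> are meaningful.\<close>

definition pert_walk :: "(nat \<Rightarrow> 'a \<Rightarrow> real) \<Rightarrow> (nat \<Rightarrow> 'a \<Rightarrow> real) \<Rightarrow> nat \<Rightarrow> 'a \<Rightarrow> real" where
  "pert_walk \<xi> \<eta> n \<omega> = walk \<xi> (n - 1) \<omega> + \<eta> n \<omega>"

definition positively_divergent ::
    "'a measure \<Rightarrow> (nat \<Rightarrow> 'a \<Rightarrow> real) \<Rightarrow> (nat \<Rightarrow> 'a \<Rightarrow> real) \<Rightarrow> bool" where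
  "positively_divergent M \<xi> \<eta> \<longleftrightarrow>
     (AE \<omega> in M. filterlim (\<lambda>n. pert_walk \<xi> \<eta> n \<omega>) at_top sequentially)"

text \<open>The counting variables are extended-valued, since \<^const>\<open>card\<close> is 0 on infinite sets.\<close>

definition num_elems :: "nat set \<Rightarrow> enat" where
  "num_elems A = (if finite A then enat (card A) else \<infinity>)"

definition visits :: "(nat \<Rightarrow> 'a \<Rightarrow> real) \<Rightarrow> (nat \<Rightarrow> 'a \<Rightarrow> real) \<Rightarrow> real \<Rightarrow> 'a \<Rightarrow> enat" where
  "visits \<xi> \<eta> x \<omega> = num_elems {n. 1 \<le> n \<and> pert_walk \<xi> \<eta> n \<omega> \<le> x}"

definition visits_star :: "(nat \<Rightarrow> 'a \<Rightarrow> real) \<Rightarrow> real \<Rightarrow> 'a \<Rightarrow> enat" where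
  "visits_star \<xi> x \<omega> = num_elems {n. walk \<xi> n \<omega> \<le> x}"

text \<open>\<open>E exp (a K)\<close> as an element of \<open>[0, \<infinity>]\<close>, with \<open>exp (a * \<infinity>) = \<infinity>\<close>; used for \<open>a > 0\<close> only.\<close>

definition exp_moment :: "'a measure \<Rightarrow> real \<Rightarrow> ('a \<Rightarrow> enat) \<Rightarrow> ennreal" where
  "exp_moment M a K =
     (\<integral>\<^sup>+ \<omega>. (case K \<omega> of enat n \<Rightarrow> ennreal (exp (a * real n)) | \<infinity> \<Rightarrow> \<infinity>) \<partial>M)"

definition neg_log :: "ennreal \<Rightarrow> ereal" where
  "neg_log p = (if p = 0 then \<infinity> else if p = \<infinity> then - \<infinity> else ereal (- ln (enn2real p)))"

definition zero_step_condition ::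
    "'a measure \<Rightarrow> ('a \<Rightarrow> real) \<Rightarrow> ('a \<Rightarrow> real) \<Rightarrow> real \<Rightarrow> real \<Rightarrow> bool" where
  "zero_step_condition M \<xi> \<eta> a x \<longleftrightarrow>
     exp a * measure M {\<omega> \<in> space M. \<xi> \<omega> = 0 \<and> \<eta> \<omega> \<le> x}
       + measure M {\<omega> \<in> space M. \<xi> \<omega> = 0 \<and> \<eta> \<omega> > x} < 1"

definition crit_exponent :: "'a measure \<Rightarrow> ('a \<Rightarrow> real) \<Rightarrow> ('a \<Rightarrow> real) \<Rightarrow> real \<Rightarrow> ereal" where
  "crit_exponent M \<xi> \<eta> x = (SUP a \<in> {a. 0 < a \<and> zero_step_condition M \<xi> \<eta> a x}. ereal a)"

definition laplace_rate :: "'a measure \<Rightarrow> ('a \<Rightarrow> real) \<Rightarrow> ereal" where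
  "laplace_rate M \<xi> = neg_log (INF t \<in> {0..}. \<integral>\<^sup>+ \<omega>. ennreal (exp (- t * \<xi> \<omega>)) \<partial>M)"

end

(*
  Part (a) and the implication from (5) share one mechanism. For x close to minus infinity a visit
  below x is unlikely, and after the first one the walk starts afresh from a random level; comparing
  the moment at that level with the moment at x gives a contraction, hence finiteness for some x. If
  xi >= 0 the new level is not higher and the comparison is monotonicity. In general it costs the
  exponential moment of a first passage time, which grows no faster than exp (theta y) when
  e^a E exp (-theta xi) <= 1, also in the critical case a = R. Finiteness is then propagated to all x
  by one-step equations.

  Conversely, finiteness of the moments forces finite passage moments of the walk restricted to
  bounded eta. These are submultiplicative in the level, and their exponential growth rate theta
  satisfies e^a E exp (-theta xi) <= 1 by comparing Laplace transforms.
*)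

theory Submission
  imports Defs
begin

text \<open>With e^a E exp(-\<theta> \<xi>) \<le> 1 the process exp(a n - \<theta> S_n) is a
  supermartingale, but stopping it on exceeding a level y only bounds E exp(a \<tau> - \<theta>
  S_\<tau>), and the overshoot S_\<tau> - y has no bound. The estimate for passage moments therefore
  has to do without overshoot control. At a = R the tilted kernel can have mass exactly 1, so a
  single step gives no contraction factor either; it is gained over several steps from the chance of
  leaving through the boundary. Moments are truncated to n steps, hence finite, whenever a multiple
  of a moment is absorbed into itself. As \<xi> and \<eta> may be dependent, the recursions
  condition on the first pair as a whole. In the converse direction \<xi> is also cut off from
  below, which keeps the boundary error in the comparison of Laplace transforms bounded. The
  exponents found for the cut-off laws stay in a compact set because P{\<xi> < 0} > 0, and Fatou's
  lemma passes to the limit.\<close>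

section \<open>Moments of first passage times\<close>

text \<open>For \<open>Q\<close> equal to \<open>e\<^sup>a\<close> times the law of \<open>\<xi>\<close>, \<open>passage_moment Q n y\<close> is the exponential moment
  \<open>E exp (a min(n, \<tau>))\<close> of the time \<open>\<tau>\<close> at which the walk first exceeds the level \<open>y\<close>.\<close>

primrec passage_moment :: "real measure \<Rightarrow> nat \<Rightarrow> real \<Rightarrow> ennreal" where
  "passage_moment Q 0 = (\<lambda>y. 1)"
| "passage_moment Q (Suc n) = (\<lambda>y. if y < 0 then 1 else \<integral>\<^sup>+ s. passage_moment Q n (y - s) \<partial>Q)"

locale step_measure = finite_measure Q for Q :: "real measure" +
  assumes sets_Q [measurable_cong]: "sets Q = sets borel"
begin

lemma space_Q [simp]: "space Q = UNIV"
  using sets_eq_imp_space_eq[OF sets_Q] by simp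

lemma passage_moment_measurable [measurable]: "passage_moment Q n \<in> borel_measurable borel"
proof (induction n)
  case (Suc n)
  note Suc [measurable]
  show ?case by simp
qed simp

lemma passage_moment_neg: "y < 0 \<Longrightarrow> passage_moment Q n y = 1"
  by (cases n) auto

text \<open>For fixed \<open>n\<close> the bound is crude but uniform in \<open>y\<close>; it makes
  the least constant in an exponential bound finite before that constant is controlled uniformly in
  \<open>n\<close>.\<close>

lemma passage_moment_bounded: "\<exists>b\<ge>0. \<forall>y. passage_moment Q n y \<le> ennreal b"
proof (induction n)
  case 0
  show ?case by (intro exI[of _ 1]) simp
next
  case (Suc n)
  then obtain b where b: "b \<ge> 0" "\<And>y. passage_moment Q n y \<le> ennreal b" by blast
  have "passage_moment Q (Suc n) y \<le> ennreal (1 + b * measure Q UNIV)" for y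
  proof (cases "y < 0")
    case True
    then show ?thesis using b(1) by simp
  next
    case False
    have "(\<integral>\<^sup>+ s. passage_moment Q n (y - s) \<partial>Q) \<le> (\<integral>\<^sup>+ s. ennreal b \<partial>Q)"
      by (intro nn_integral_mono b)
    also have "\<dots> = ennreal (b * measure Q UNIV)"
      using b(1) by (simp add: emeasure_eq_measure ennreal_mult)
    also have "\<dots> \<le> ennreal (1 + b * measure Q UNIV)" by (intro ennreal_leI) simp
    finally show ?thesis using False by simp
  qed
  then show ?case using b(1) by (intro exI[of _ "1 + b * measure Q UNIV"]) auto
qed

end

text \<open>In the applications \<open>Q\<close> carries the factor e^a. Mass above 1 makes every
  further step increase the moments, hence their monotonicity in \<open>n\<close> and
  \<open>y\<close>. A truncated law may fail to exceed mass 1 and is then treated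
  separately.\<close>

locale heavy_step_measure = step_measure +
  assumes mass_gt_1: "emeasure Q UNIV > 1"
begin

lemma passage_moment_ge_1: "1 \<le> passage_moment Q n y"
proof (induction n arbitrary: y)
  case (Suc n)
  have "1 \<le> (\<integral>\<^sup>+ s. 1 \<partial>Q)" using mass_gt_1 by simp
  also have "\<dots> \<le> (\<integral>\<^sup>+ s. passage_moment Q n (y - s) \<partial>Q)" by (intro nn_integral_mono Suc)
  finally show ?case by simp
qed simp

lemma passage_moment_mono: "x \<le> y \<Longrightarrow> passage_moment Q n x \<le> passage_moment Q n y"
proof (induction n arbitrary: x y)
  case (Suc n)
  show ?case
  proof (cases "x < 0")
    case True
    then show ?thesis using passage_moment_ge_1[of "Suc n" y] by simp
  next
    case False
    then show ?thesis using Suc.prems by (auto intro!: nn_integral_mono Suc.IH)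
  qed
qed simp

lemma passage_moment_Suc_ge: "passage_moment Q n y \<le> passage_moment Q (Suc n) y"
proof (induction n arbitrary: y)
  case 0
  show ?case using passage_moment_ge_1[of "Suc 0" y] by simp
next
  case (Suc n)
  show ?case
  proof (cases "y < 0")
    case True
    then show ?thesis by simp
  next
    case False
    have "passage_moment Q (Suc n) y = (\<integral>\<^sup>+ s. passage_moment Q n (y - s) \<partial>Q)" using False by simp
    also have "\<dots> \<le> (\<integral>\<^sup>+ s. passage_moment Q (Suc n) (y - s) \<partial>Q)" by (intro nn_integral_mono Suc)
    also have "\<dots> = passage_moment Q (Suc (Suc n)) y" using False by (simp only: passage_moment.simps if_False)
    finally show ?thesis .
  qed
qed

lemma incseq_passage_moment: "incseq (\<lambda>n. passage_moment Q n y)"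
  by (intro incseq_SucI passage_moment_Suc_ge)

text \<open>To exceed \<open>x + y\<close> the walk must exceed \<open>x\<close> no later, after
  which a level of less than \<open>y\<close> remains; the clock of the second stage is restarted
  with all \<open>n\<close> steps.\<close>

lemma passage_moment_submult:
  assumes "0 \<le> y"
  shows "passage_moment Q n (x + y) \<le> (if x < 0 then 1 else passage_moment Q n x) * passage_moment Q n y"
proof (induction n arbitrary: x)
  case (Suc n)
  show ?case
  proof (cases "x < 0")
    case True
    then show ?thesis using passage_moment_mono[of "x + y" y "Suc n"] by simp
  next
    case False
    have "passage_moment Q (Suc n) (x + y) = (\<integral>\<^sup>+ s. passage_moment Q n ((x - s) + y) \<partial>Q)"
      using False assms by (simp add: algebra_simps)
    also have "\<dots> \<le> (\<integral>\<^sup>+ s. (if x - s < 0 then 1 else passage_moment Q n (x - s)) * passage_moment Q n y \<partial>Q)"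
      by (intro nn_integral_mono Suc)
    also have "\<dots> = (\<integral>\<^sup>+ s. passage_moment Q n (x - s) * passage_moment Q n y \<partial>Q)"
      by (intro nn_integral_cong) (auto simp: passage_moment_neg)
    also have "\<dots> = (\<integral>\<^sup>+ s. passage_moment Q n (x - s) \<partial>Q) * passage_moment Q n y"
      by (rule nn_integral_multc) simp
    also have "\<dots> \<le> (\<integral>\<^sup>+ s. passage_moment Q n (x - s) \<partial>Q) * passage_moment Q (Suc n) y"
      by (intro mult_left_mono passage_moment_Suc_ge) auto
    finally show ?thesis using False by simp
  qed
qed simp

text \<open>The tilted kernel \<open>exp (- \<theta> s) Q(ds)\<close> is substochastic but may be stochastic, so only the least
  \<open>W\<close> with \<open>passage_moment Q N y \<le> W exp (\<theta> y)\<close> is controlled. Below a level \<open>L\<close>, the tilted walk is killed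
  within \<open>m\<close> steps with probability at least \<open>1 - \<rho> m > 0\<close>; above \<open>L\<close>, where \<open>Q {..y} > 1\<close>, a
  function \<open>w exp (\<theta> y) - D\<close> is a supersolution. Together these give \<open>W \<le> const + \<rho> m W\<close>.\<close>

lemma passage_moment_exp_bound:
  assumes \<theta>: "\<theta> > 0" and sub: "(\<integral>\<^sup>+ s. ennreal (exp (- \<theta> * s)) \<partial>Q) \<le> 1"
  shows "\<exists>Z\<ge>0. \<forall>n y. passage_moment Q n y \<le> 1 + ennreal (Z * exp (\<theta> * y))"
proof -
  define c where "c = measure Q UNIV"
  have c: "c > 1" and emQ: "emeasure Q UNIV = ennreal c"
    using mass_gt_1 by (auto simp: c_def emeasure_eq_measure)
  have Epos: "ennreal (exp (\<theta> * y)) > 0" for y by simp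
  have shift: "(\<integral>\<^sup>+ s. ennreal (w * exp (\<theta> * (y - s))) * indicator A s \<partial>Q)
      = ennreal (w * exp (\<theta> * y)) * (\<integral>\<^sup>+ s. ennreal (exp (- \<theta> * s)) * indicator A s \<partial>Q)"
    if "A \<in> sets borel" "w \<ge> 0" for w y :: real and A
  proof -
    have *: "ennreal (w * exp (\<theta> * (y - s))) * indicator A s
        = ennreal (w * exp (\<theta> * y)) * (ennreal (exp (- \<theta> * s)) * indicator A s)" for s
    proof -
      have e: "exp (\<theta> * (y - s)) = exp (\<theta> * y) * exp (- \<theta> * s)"
        by (simp add: right_diff_distrib exp_diff exp_minus divide_inverse)
      show ?thesis unfolding e using that by (simp add: ennreal_mult mult.assoc split: split_indicator)
    qed
    show ?thesis unfolding * using that by (subst nn_integral_cmult) auto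
  qed
  \<comment> \<open>Otherwise s \<le> 0 almost everywhere, the tilt exp(-\<theta> s) is at least 1,
    and the tilted mass would exceed 1 like the mass of \<open>Q\<close>.\<close>
  have "\<exists>\<epsilon>>0. emeasure Q {\<epsilon>..} > 0"
  proof (rule ccontr)
    assume "\<not> ?thesis"
    then have *: "emeasure Q {\<epsilon>..} = 0" if "\<epsilon> > 0" for \<epsilon>
      using that by (metis not_gr_zero)
    have "AE s in Q. \<forall>n::nat. s < 1 / Suc n"
      unfolding AE_all_countable
    proof
      fix n :: nat
      show "AE s in Q. s < 1 / Suc n"
        by (rule AE_I[OF _ *[of "1 / Suc n"]]) (auto simp: not_less)
    qed
    then have "AE s in Q. s \<le> 0"
    proof eventually_elim
      case (elim s)
      show ?case
      proof (rule ccontr)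
        assume "\<not> s \<le> 0"
        then obtain n where "1 / Suc n < s" using nat_approx_posE by (metis not_le)
        then show False using elim[rule_format, of n] by simp
      qed
    qed
    then have "(\<integral>\<^sup>+ s. 1 \<partial>Q) \<le> (\<integral>\<^sup>+ s. ennreal (exp (- \<theta> * s)) \<partial>Q)"
      using \<theta> by (intro nn_integral_mono_AE) (auto elim!: eventually_mono simp: mult_nonneg_nonpos)
    then have "emeasure Q UNIV \<le> 1" using sub by simp
    then show False using mass_gt_1 by simp
  qed
  then obtain \<epsilon> where \<epsilon>: "\<epsilon> > 0" "emeasure Q {\<epsilon>..} > 0" by blast
  \<comment> \<open>Tilted masses of the steps of size at least \<epsilon> and of the smaller ones;
    the former lower the level by a fixed amount.\<close>
  define q where "q = (\<integral>\<^sup>+ s. ennreal (exp (- \<theta> * s)) * indicator {\<epsilon>..} s \<partial>Q)"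
  define r where "r = (\<integral>\<^sup>+ s. ennreal (exp (- \<theta> * s)) * indicator {..<\<epsilon>} s \<partial>Q)"
  have "r + q = (\<integral>\<^sup>+ s. ennreal (exp (- \<theta> * s)) \<partial>Q)"
    unfolding r_def q_def
    by (subst nn_integral_add[symmetric]) (auto intro!: nn_integral_cong split: split_indicator)
  with sub have rq: "r + q \<le> 1" by simp
  have "q \<noteq> 0"
  proof
    assume "q = 0"
    then have "AE s in Q. ennreal (exp (- \<theta> * s)) * indicator {\<epsilon>..} s = 0"
      unfolding q_def by (subst (asm) nn_integral_0_iff_AE) auto
    then have "AE s in Q. s \<notin> {\<epsilon>..}"
      by eventually_elim (auto split: split_indicator_asm)
    then have "emeasure Q {\<epsilon>..} = 0" by (subst (asm) AE_iff_measurable[OF _ refl]) (auto simp: atLeast_def)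
    then show False using \<epsilon> by simp
  qed
  have "r \<le> 1" "q \<le> 1" using order_trans[OF _ rq, of r] order_trans[OF _ rq, of q] by simp_all
  then have "r < \<infinity>" "q < \<infinity>" by (auto intro: le_less_trans)
  then obtain r' q' where r': "r = ennreal r'" "r' \<ge> 0" and q': "q = ennreal q'" "q' \<ge> 0"
    by (cases r; cases q) auto
  have q'0: "q' > 0" using \<open>q \<noteq> 0\<close> q' by auto
  have rq': "r' + q' \<le> 1" using rq r' q' by (simp flip: ennreal_plus)
  \<comment> \<open>A small step, of tilted mass \<open>r'\<close>, is charged the whole bound
    \<open>W\<close>; a large one, of tilted mass \<open>q'\<close>, reduces \<open>m\<close> by
    one. The start 0 is right because the band for m = 0 is empty. \<open>B\<close> collects the
    untilted contributions: 1 for an exit and \<open>B m\<close> otherwise, times the mass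
    \<open>c\<close>.\<close>
  define \<rho> where "\<rho> m = ((\<lambda>x. r' + x * q') ^^ m) 0" for m
  define B where "B m = ((\<lambda>x. c + c * x) ^^ m) 0" for m
  have \<rho>_Suc: "\<rho> (Suc m) = r' + \<rho> m * q'" and B_Suc: "B (Suc m) = c + c * B m" for m
    by (simp_all add: \<rho>_def B_def)
  have \<rho>: "\<rho> m \<ge> 0 \<and> \<rho> m < 1" for m
  proof (induction m)
    case (Suc m)
    have "\<rho> m * q' < 1 * q'" using Suc q'0 by (intro mult_strict_right_mono) auto
    then show ?case using Suc rq' r'(2) q'(2) by (auto simp: \<rho>_Suc)
  qed (simp add: \<rho>_def)
  have B: "B m \<ge> 0" for m
    using c by (induction m) (auto simp: B_Suc, simp add: B_def)
  have band: "passage_moment Q N y \<le> ennreal (B m + \<rho> m * W * exp (\<theta> * y))"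
    if W: "W \<ge> 0" "\<And>y. y \<ge> 0 \<Longrightarrow> passage_moment Q N y \<le> ennreal (W * exp (\<theta> * y))"
      and y: "0 \<le> y" "y < real m * \<epsilon>" for N W m y
    using y
  proof (induction m arbitrary: y)
    case (Suc m)
    have "passage_moment Q N y \<le> (\<integral>\<^sup>+ s. passage_moment Q N (y - s) \<partial>Q)"
      using passage_moment_Suc_ge[of N y] Suc.prems by simp
    also have "\<dots> \<le> (\<integral>\<^sup>+ s. (ennreal (1 + B m) + ennreal (W * exp (\<theta> * (y - s))) * indicator {..<\<epsilon>} s)
        + ennreal (\<rho> m * W * exp (\<theta> * (y - s))) * indicator {\<epsilon>..} s \<partial>Q)"
    proof (intro nn_integral_mono)
      fix s
      consider "y - s < 0" | "y - s \<ge> 0" "s < \<epsilon>" | "y - s \<ge> 0" "s \<ge> \<epsilon>" by linarith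
      then show "passage_moment Q N (y - s) \<le> (ennreal (1 + B m) + ennreal (W * exp (\<theta> * (y - s))) * indicator {..<\<epsilon>} s)
        + ennreal (\<rho> m * W * exp (\<theta> * (y - s))) * indicator {\<epsilon>..} s"
      proof cases
        case 1
        then have "passage_moment Q N (y - s) \<le> ennreal (1 + B m)" using B[of m] by (simp add: passage_moment_neg)
        then show ?thesis by (meson add_increasing2 zero_le)
      next
        case 2
        then show ?thesis using W(2)[of "y - s"] by (simp add: add_increasing)
      next
        case 3
        then have "passage_moment Q N (y - s) \<le> ennreal (B m + \<rho> m * W * exp (\<theta> * (y - s)))"
          using Suc.prems by (intro Suc.IH) (auto simp: algebra_simps)
        also have "\<dots> \<le> ennreal (1 + B m) + ennreal (\<rho> m * W * exp (\<theta> * (y - s)))"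
          using B[of m] \<rho>[of m] W(1) by (subst ennreal_plus[symmetric]) (auto intro!: ennreal_leI)
        finally show ?thesis using 3 by simp
      qed
    qed
    also have "\<dots> = ennreal (1 + B m) * ennreal c + ennreal (W * exp (\<theta> * y)) * r
        + ennreal (\<rho> m * W * exp (\<theta> * y)) * q"
      using W(1) \<rho>[of m] by (simp add: nn_integral_add shift r_def q_def emQ)
    also have "\<dots> = ennreal (B (Suc m) + \<rho> (Suc m) * W * exp (\<theta> * y))"
      using W(1) \<rho>[of m] B[of m] c r' q'
      by (simp add: ennreal_mult[symmetric] ennreal_plus[symmetric] \<rho>_Suc B_Suc algebra_simps del: ennreal_plus)
    finally show ?case .
  qed simp
  have "(\<lambda>n. emeasure Q {..real n}) \<longlonglongrightarrow> emeasure Q (\<Union>n. {..real n})"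
    by (intro Lim_emeasure_incseq) (auto simp: incseq_def)
  moreover have "(\<Union>n. {..real n}) = UNIV" using real_arch_simple by auto
  ultimately have "(\<lambda>n. emeasure Q {..real n}) \<longlonglongrightarrow> emeasure Q UNIV" by simp
  then have "eventually (\<lambda>n. emeasure Q {..real n} > 1) sequentially"
    using mass_gt_1 by (rule order_tendstoD(1))
  then obtain L :: nat where "emeasure Q {..real L} > 1" by (auto simp: eventually_sequentially)
  then obtain G where G: "G > 1" "emeasure Q {..real L} = ennreal G"
    by (metis emeasure_eq_measure ennreal_1 ennreal_less_iff zero_le_one)
  \<comment> \<open>Solves D G = D + c. From a level above \<open>L\<close> the subtracted constant
    gains at least D G in one step, which pays for D itself and for the at most c contributed by
    steps that leave.\<close>
  define D where "D = c / (G - 1)"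
  have D: "D > 0" "D * G = D + c" using G(1) c by (auto simp: D_def field_simps)
  have far: "passage_moment Q n y + ennreal D \<le> ennreal ((b + D) * exp (\<theta> * y))"
    if b: "b \<ge> 1" "\<And>y. 0 \<le> y \<Longrightarrow> y < real L \<Longrightarrow> passage_moment Q N y \<le> ennreal (b * exp (\<theta> * y))"
      and y: "0 \<le> y" and n: "n \<le> N" for b N y n
    using y n
  proof (induction n arbitrary: y)
    case 0
    have "1 + D \<le> (b + D) * exp (\<theta> * y)"
      using b(1) D(1) \<theta> 0 by (intro order_trans[OF _ mult_left_mono[of 1 "exp (\<theta> * y)"]]) auto
    then show ?case using D by (simp add: ennreal_plus[symmetric] ennreal_1[symmetric] ennreal_leI del: ennreal_plus ennreal_1)
  next
    case (Suc n)
    show ?case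
    proof (cases "y < real L")
      case True
      have "passage_moment Q (Suc n) y \<le> passage_moment Q N y" using incseqD[OF incseq_passage_moment] Suc.prems by blast
      also have "\<dots> \<le> ennreal (b * exp (\<theta> * y))" using b(2) True Suc.prems by auto
      finally have "passage_moment Q (Suc n) y + ennreal D \<le> ennreal (b * exp (\<theta> * y)) + ennreal (D * exp (\<theta> * y))"
        using D \<theta> Suc.prems by (intro add_mono ennreal_leI) auto
      then show ?thesis using b(1) D by (simp add: ennreal_plus[symmetric] distrib_right del: ennreal_plus)
    next
      case False
      have Gy: "ennreal G \<le> emeasure Q {..y}" using False G(2)[symmetric] by (auto intro!: emeasure_mono)
      have "passage_moment Q (Suc n) y + ennreal D * emeasure Q {..y}
          = (\<integral>\<^sup>+ s. passage_moment Q n (y - s) + ennreal D * indicator {..y} s \<partial>Q)"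
        using Suc.prems by (simp add: nn_integral_add nn_integral_cmult)
      also have "\<dots> \<le> (\<integral>\<^sup>+ s. 1 + ennreal ((b + D) * exp (\<theta> * (y - s))) * indicator UNIV s \<partial>Q)"
      proof (intro nn_integral_mono)
        fix s
        show "passage_moment Q n (y - s) + ennreal D * indicator {..y} s
            \<le> 1 + ennreal ((b + D) * exp (\<theta> * (y - s))) * indicator UNIV s"
          using Suc.IH[of "y - s"] Suc.prems
          by (cases "s \<le> y") (auto simp: passage_moment_neg add_increasing)
      qed
      also have "\<dots> = ennreal c + ennreal ((b + D) * exp (\<theta> * y)) * (\<integral>\<^sup>+ s. ennreal (exp (- \<theta> * s)) * indicator UNIV s \<partial>Q)"
        using b(1) D(1) using shift[of UNIV "b + D" y]
        by (subst nn_integral_add) (simp_all add: emQ)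
      also have "\<dots> \<le> ennreal c + ennreal ((b + D) * exp (\<theta> * y))"
        using sub by (intro add_left_mono) (simp add: mult_left_le)
      finally have 1: "passage_moment Q (Suc n) y + ennreal D * emeasure Q {..y} \<le> ennreal c + ennreal ((b + D) * exp (\<theta> * y))" .
      have "ennreal c + (passage_moment Q (Suc n) y + ennreal D) = passage_moment Q (Suc n) y + ennreal D * ennreal G"
        using D c G by (simp add: ennreal_mult[symmetric] ac_simps)
      also have "\<dots> \<le> ennreal c + ennreal ((b + D) * exp (\<theta> * y))"
        by (rule order_trans[OF _ 1]) (intro add_left_mono mult_left_mono Gy zero_le)
      finally show ?thesis by (simp add: ennreal_add_left_cancel_le)
    qed
  qed
  obtain m :: nat where m: "real L < real m * \<epsilon>" using \<epsilon> reals_Archimedean3 by blast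
  \<comment> \<open>The largest \<open>w\<close> compatible with
    \<open>w \<le> B m + 1 + D + \<rho> m * w\<close>, the inequality obtained below for the least
    admissible constant.\<close>
  define Z where "Z = (B m + 1 + D) / (1 - \<rho> m)"
  have Zb: "passage_moment Q N y \<le> ennreal (Z * exp (\<theta> * y))" if "y \<ge> 0" for N y
  proof -
    obtain b where b: "b \<ge> 0" "\<And>y. passage_moment Q N y \<le> ennreal b" using passage_moment_bounded by blast
    define W where "W = (SUP y\<in>{0..}. passage_moment Q N y * ennreal (exp (- \<theta> * y)))"
    have cancel: "k \<le> ennreal (w * exp (\<theta> * y)) \<longleftrightarrow> k * ennreal (exp (- \<theta> * y)) \<le> ennreal w"
      if "w \<ge> 0" for k w y
    proof (cases k)
      case (real r)
      have "r \<le> w * exp (\<theta> * y) \<longleftrightarrow> r * exp (- \<theta> * y) \<le> w" by (simp add: exp_minus field_simps)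
      then show ?thesis using real that by (simp add: ennreal_mult[symmetric] ennreal_le_iff)
    qed (simp add: ennreal_top_mult top_unique)
    have W_le: "W \<le> ennreal v" if "v \<ge> 0" "\<And>y. y \<ge> 0 \<Longrightarrow> passage_moment Q N y \<le> ennreal (v * exp (\<theta> * y))" for v
      unfolding W_def using that by (intro SUP_least cancel[THEN iffD1]) auto
    have "W \<le> ennreal b"
    proof (rule W_le[OF b(1)])
      fix y :: real assume "y \<ge> 0"
      then have "b * 1 \<le> b * exp (\<theta> * y)" using b(1) \<theta> by (intro mult_left_mono) auto
      then show "passage_moment Q N y \<le> ennreal (b * exp (\<theta> * y))" by (intro order_trans[OF b(2)] ennreal_leI) simp
    qed
    then obtain w where w: "W = ennreal w" "w \<ge> 0"
      by (cases W) (auto simp: top_unique)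
    have W: "passage_moment Q N y \<le> ennreal (w * exp (\<theta> * y))" if "y \<ge> 0" for y
      unfolding cancel[OF w(2)] w(1)[symmetric] W_def using that by (intro SUP_upper) auto
    have bd: "passage_moment Q N y \<le> ennreal ((B m + 1 + \<rho> m * w) * exp (\<theta> * y))" if "0 \<le> y" "y < real L" for y
    proof -
      have "passage_moment Q N y \<le> ennreal (B m + \<rho> m * w * exp (\<theta> * y))"
        using that m by (intro band w W) auto
      also have "\<dots> \<le> ennreal ((B m + 1 + \<rho> m * w) * exp (\<theta> * y))"
        using mult_left_mono[of 1 "exp (\<theta> * y)" "B m + 1"] B[of m] \<theta> that
        by (intro ennreal_leI) (simp add: algebra_simps)
      finally show ?thesis .
    qed
    have "passage_moment Q N y \<le> ennreal ((B m + 1 + D + \<rho> m * w) * exp (\<theta> * y))" if "y \<ge> 0" for y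
    proof -
      have "passage_moment Q N y \<le> passage_moment Q N y + ennreal D" by simp
      also have "\<dots> \<le> ennreal ((B m + 1 + \<rho> m * w + D) * exp (\<theta> * y))"
        using far[of "B m + 1 + \<rho> m * w" N y N] bd that B[of m] \<rho>[of m] w by auto
      finally show ?thesis by (simp add: ac_simps)
    qed
    then have "W \<le> ennreal (B m + 1 + D + \<rho> m * w)"
      using B[of m] \<rho>[of m] w D by (intro W_le) auto
    moreover have "0 \<le> B m + 1 + D + \<rho> m * w" using w(2) B[of m] \<rho>[of m] D by simp
    ultimately have "w \<le> B m + 1 + D + \<rho> m * w" unfolding w(1) by (simp only: ennreal_le_iff)
    then have "w \<le> Z" using \<rho>[of m] by (simp add: Z_def field_simps)
    then show ?thesis by (intro order_trans[OF W[OF that]] ennreal_leI mult_right_mono) auto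
  qed
  have "Z \<ge> 0" using B[of m] \<rho>[of m] D by (simp add: Z_def)
  moreover have "passage_moment Q n y \<le> 1 + ennreal (Z * exp (\<theta> * y))" for n y
    using Zb[of y n] by (cases "y < 0") (auto simp: passage_moment_neg add_increasing)
  ultimately show ?thesis by blast
qed

end

section \<open>Exponential growth rate of the passage moments\<close>

lemma nn_integral_exp_decay:
  assumes "u > 0"
  shows "(\<integral>\<^sup>+ x. ennreal (exp (- u * x)) * indicator {0..} x \<partial>lborel) = ennreal (1 / u)"
proof -
  have "(\<integral>\<^sup>+ x. ennreal (exp (- u * x)) * indicator {0..} x \<partial>lborel) = ennreal (0 - (- exp (- u * 0) / u))"
  proof (rule nn_integral_FTC_atLeast[where F = "\<lambda>x. - exp (- u * x) / u"])
    show "((\<lambda>x. - exp (- u * x) / u) has_real_derivative exp (- u * x)) (at x)" for x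
      using assms by (auto intro!: derivative_eq_intros)
    show "((\<lambda>x. - exp (- u * x) / u) \<longlongrightarrow> 0) at_top"
      using assms by real_asymp
  qed auto
  then show ?thesis by simp
qed

context heavy_step_measure
begin

text \<open>The limit \<open>K\<close> of the moments is submultiplicative, hence has an exponential rate \<open>\<theta> \<ge> 0\<close> with
  \<open>K y \<ge> exp (\<theta> y)\<close>, so that its Laplace transform \<open>l\<close> is finite for \<open>t > \<theta>\<close> and blows up at \<open>\<theta>\<close>.
  Transforming \<open>K y = \<integral> K (y - s) Q(ds)\<close> gives \<open>\<phi> l \<le> l + const\<close>.\<close>

lemma ex_laplace_le:
  assumes c: "0 \<le> c" "AE s in Q. - c \<le> s" and fin: "\<And>y. (SUP n. passage_moment Q n y) < \<infinity>" and \<epsilon>: "\<epsilon> > 0"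
  shows "\<exists>t\<ge>0. (\<integral>\<^sup>+ s. ennreal (exp (- t * s)) \<partial>Q) \<le> ennreal (1 + \<epsilon>)"
proof -
  define K where "K y = (SUP n. passage_moment Q n y)" for y
  have [measurable]: "K \<in> borel_measurable borel" unfolding K_def by measurable
  have K_mono: "K x \<le> K y" if "x \<le> y" for x y
    unfolding K_def using that by (intro SUP_mono) (auto intro: passage_moment_mono)
  have K_ge_1: "1 \<le> K y" for y
    unfolding K_def by (rule SUP_upper2[of 0]) auto
  have K_eq: "K y = (\<integral>\<^sup>+ s. K (y - s) \<partial>Q)" if "y \<ge> 0" for y
  proof -
    have "(\<integral>\<^sup>+ s. K (y - s) \<partial>Q) = (SUP n. \<integral>\<^sup>+ s. passage_moment Q n (y - s) \<partial>Q)"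
      unfolding K_def
      by (rule nn_integral_monotone_convergence_SUP) (auto simp: incseq_Suc_iff le_fun_def passage_moment_Suc_ge simp del: passage_moment.simps)
    also have "\<dots> = (SUP n. passage_moment Q (Suc n) y)" using that by simp
    also have "\<dots> = K y" unfolding K_def using passage_moment_Suc_ge[of _ y]
      by (intro antisym SUP_mono) (auto simp del: passage_moment.simps)
    finally show ?thesis by simp
  qed
  have K_sub: "K (x + y) \<le> K x * K y" if "x \<ge> 0" "y \<ge> 0" for x y
    unfolding K_def
  proof (rule SUP_least)
    fix n
    have "passage_moment Q n (x + y) \<le> passage_moment Q n x * passage_moment Q n y" using passage_moment_submult[OF that(2), of n x] that by simp
    also have "\<dots> \<le> (SUP n. passage_moment Q n x) * (SUP n. passage_moment Q n y)"
      by (intro mult_mono SUP_upper) auto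
    finally show "passage_moment Q n (x + y) \<le> (SUP n. passage_moment Q n x) * (SUP n. passage_moment Q n y)" .
  qed
  define k where "k y = enn2real (K y)" for y
  have Kk: "K y = ennreal (k y)" for y
    using fin[of y] by (simp add: k_def K_def)
  have k1: "1 \<le> k y" for y
    using K_ge_1[of y] unfolding Kk by (auto simp: ennreal_1[symmetric] ennreal_le_iff2 simp del: ennreal_1)
  have k0: "0 < k y" for y using k1[of y] by simp
  have k_mono: "k x \<le> k y" if "x \<le> y" for x y
    using K_mono[OF that] k0[of y] unfolding Kk by (simp add: ennreal_le_iff)
  have k_sub: "k (x + y) \<le> k x * k y" if "x \<ge> 0" "y \<ge> 0" for x y
    using K_sub[OF that] k0[of x] k0[of y] unfolding Kk by (simp add: ennreal_mult[symmetric] ennreal_le_iff)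
  \<comment> \<open>The infimum of these rates is that of ln (k x) / x over x > 0, as in Fekete's
    lemma.\<close>
  define A where "A = {s. s \<ge> 0 \<and> (\<exists>x>0. k x \<le> exp (s * x))}"
  define \<theta> where "\<theta> = Inf A"
  have inA: "ln (k x) / x \<in> A" if "x > 0" for x
    unfolding A_def using that k1[of x] by (auto intro!: exI[of _ x])
  have bdd: "bdd_below A" by (rule bdd_belowI[of _ 0]) (auto simp: A_def)
  have \<theta>0: "\<theta> \<ge> 0" unfolding \<theta>_def
    using inA[of 1] by (intro cInf_greatest) (auto simp: A_def)
  have lower: "exp (\<theta> * y) \<le> k y" if "y \<ge> 0" for y
  proof (cases "y = 0")
    case False
    with that have y: "y > 0" by simp
    have "\<theta> \<le> ln (k y) / y" unfolding \<theta>_def using inA[OF y] bdd by (rule cInf_lower)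
    then have "\<theta> * y \<le> ln (k y)" using y by (simp add: field_simps)
    then show ?thesis using k0[of y] by (simp add: ln_ge_iff)
  qed (use k1 in simp)
  \<comment> \<open>Submultiplicativity along y = n x + r with 0 \<le> r \<le> x.\<close>
  have upper: "k y \<le> k x * exp (s * y)" if x: "x > 0" "k x \<le> exp (s * x)" "s \<ge> 0" "y \<ge> 0" for x s y
  proof -
    have *: "k (real n * x + r) \<le> exp (s * x) ^ n * k r" if "r \<ge> 0" for n r
    proof (induction n)
      case (Suc n)
      have "k (real (Suc n) * x + r) = k (x + (real n * x + r))" by (simp add: algebra_simps)
      also have "\<dots> \<le> k x * k (real n * x + r)" using x that by (intro k_sub) auto
      also have "\<dots> \<le> exp (s * x) * (exp (s * x) ^ n * k r)"
        using x Suc k0[THEN less_imp_le] by (intro mult_mono) auto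
      finally show ?case by simp
    qed simp
    define n where "n = nat \<lfloor>y / x\<rfloor>"
    define r where "r = y - real n * x"
    have n: "real n = of_int \<lfloor>y / x\<rfloor>" using x by (simp add: n_def)
    have "real n \<le> y / x" "y / x < real n + 1" unfolding n by linarith+
    then have r: "r \<ge> 0" "r \<le> x" "real n * x \<le> y" using x by (auto simp: r_def field_simps)
    have "k y \<le> exp (s * x) ^ n * k r" using *[OF r(1), of n] by (simp add: r_def)
    also have "exp (s * x) ^ n = exp (s * (real n * x))"
      by (simp add: exp_of_nat_mult[symmetric] algebra_simps)
    also have "\<dots> * k r \<le> exp (s * y) * k x"
      using r x k0[THEN less_imp_le] by (intro mult_mono k_mono) (auto intro!: mult_left_mono)
    finally show ?thesis by (simp add: mult.commute)
  qed
  \<comment> \<open>Bounds the error caused by a step s \<ge> -c: the integral of exp(-t x) K(x - s)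
    over s \<le> x < 0, a set of length at most c on which -x \<le> c, x - s \<le> c and t \<le>
    \<theta> + 1.\<close>
  define C where "C = exp ((\<theta> + 1) * c) * k c * c"
  have C0: "C \<ge> 0" using c k0[of c] by (simp add: C_def)
  define m where "m = measure Q UNIV"
  have m: "emeasure Q UNIV = ennreal m" "m \<ge> 0" by (auto simp: m_def emeasure_eq_measure)
  \<comment> \<open>Small enough that the total error C m is at most \<epsilon> times the Laplace
    transform, which is at least 1/\<delta>. The cap at 1 keeps t \<le> \<theta> + 1, so that
    \<open>C\<close> can be fixed before \<open>\<delta>\<close>.\<close>
  define \<delta> where "\<delta> = min 1 (\<epsilon> / (C * m + 1))"
  have Cm: "C * m \<ge> 0" using C0 m by simp
  have \<delta>: "0 < \<delta>" "\<delta> \<le> 1" using \<epsilon> Cm by (auto simp: \<delta>_def)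
  have \<delta>2: "C * m * \<delta> \<le> \<epsilon>"
  proof -
    have "\<delta> * (C * m + 1) \<le> \<epsilon> / (C * m + 1) * (C * m + 1)"
      using Cm by (intro mult_right_mono) (auto simp: \<delta>_def)
    also have "\<dots> = \<epsilon>" using Cm by simp
    finally show ?thesis using \<delta> by (simp add: algebra_simps)
  qed
  define t where "t = \<theta> + \<delta>"
  have t: "t > \<theta>" "t \<ge> 0" "t \<le> \<theta> + 1" using \<delta> \<theta>0 by (auto simp: t_def)
  define l where "l = (\<integral>\<^sup>+ x. ennreal (exp (- t * x)) * K x * indicator {0..} x \<partial>lborel)"
  define \<phi> where "\<phi> = (\<integral>\<^sup>+ s. ennreal (exp (- t * s)) \<partial>Q)"
  have l_ge: "ennreal (1 / \<delta>) \<le> l"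
  proof -
    have "ennreal (1 / \<delta>) = (\<integral>\<^sup>+ x. ennreal (exp (- \<delta> * x)) * indicator {0..} x \<partial>lborel)"
      using \<delta> by (simp only: nn_integral_exp_decay)
    also have "\<dots> \<le> l" unfolding l_def
    proof (intro nn_integral_mono)
      fix x :: real
      show "ennreal (exp (- \<delta> * x)) * indicator {0..} x \<le> ennreal (exp (- t * x)) * K x * indicator {0..} x"
      proof (cases "x \<ge> 0")
        case True
        have "exp (- \<delta> * x) = exp (- t * x) * exp (\<theta> * x)" by (simp add: t_def exp_add[symmetric] algebra_simps)
        also have "\<dots> \<le> exp (- t * x) * k x" using lower[OF True] by (intro mult_left_mono) auto
        finally show ?thesis using k0[of x] unfolding Kk by (simp add: ennreal_mult[symmetric] ennreal_leI split: split_indicator)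
      qed simp
    qed
    finally show ?thesis .
  qed
  have l_fin: "l < \<infinity>"
  proof -
    have "\<exists>s\<in>A. s < t" using t(1) inA[of 1] bdd unfolding \<theta>_def by (subst (asm) cInf_less_iff) auto
    then obtain s x where s: "s \<ge> 0" "x > 0" "k x \<le> exp (s * x)" "s < t" by (auto simp: A_def)
    have "l \<le> (\<integral>\<^sup>+ y. ennreal (k x) * (ennreal (exp (- (t - s) * y)) * indicator {0..} y) \<partial>lborel)"
      unfolding l_def
    proof (intro nn_integral_mono)
      fix y :: real
      show "ennreal (exp (- t * y)) * K y * indicator {0..} y \<le> ennreal (k x) * (ennreal (exp (- (t - s) * y)) * indicator {0..} y)"
      proof (cases "y \<ge> 0")
        case True
        have "exp (- t * y) * k y \<le> exp (- t * y) * (k x * exp (s * y))" using upper[OF s(2,3,1) True] by (intro mult_left_mono) auto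
        also have "\<dots> = k x * exp (- (t - s) * y)" by (simp add: left_diff_distrib exp_diff exp_minus field_simps)
        finally show ?thesis using k0[of x] k0[of y] unfolding Kk by (simp add: ennreal_mult[symmetric] ennreal_leI split: split_indicator)
      qed simp
    qed
    also have "\<dots> = ennreal (k x) * ennreal (1 / (t - s))"
      using s nn_integral_exp_decay[of "t - s"] by (subst nn_integral_cmult) auto
    also have "\<dots> < \<infinity>" by (simp add: ennreal_mult_less_top)
    finally show ?thesis .
  qed
  \<comment> \<open>Substituting x = y + s turns the left side into an integral over x \<ge> s;
    compared with x \<ge> 0 only [s, 0) is extra, for negative s.\<close>
  have step: "ennreal (exp (- t * s)) * l
      \<le> (\<integral>\<^sup>+ x. ennreal (exp (- t * x)) * K (x - s) * indicator {0..} x \<partial>lborel) + ennreal C"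
    if s: "- c \<le> s" for s
  proof -
    have "ennreal (exp (- t * s)) * l = (\<integral>\<^sup>+ y. ennreal (exp (- t * s)) * (ennreal (exp (- t * y)) * K y * indicator {0..} y) \<partial>lborel)"
      unfolding l_def by (subst nn_integral_cmult) auto
    also have "\<dots> = (\<integral>\<^sup>+ x. ennreal (exp (- t * s)) * (ennreal (exp (- t * (- s + 1 * x))) * K (- s + 1 * x) * indicator {0..} (- s + 1 * x)) \<partial>lborel)"
      by (subst nn_integral_real_affine[where c = 1 and t = "- s"]) auto
    also have "\<dots> \<le> (\<integral>\<^sup>+ x. ennreal (exp (- t * x)) * K (x - s) * indicator {0..} x
        + ennreal (exp ((\<theta> + 1) * c) * k c) * indicator {- c..0} x \<partial>lborel)"
    proof (intro nn_integral_mono)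
      fix x :: real
      have e: "ennreal (exp (- t * s)) * ennreal (exp (- t * (- s + 1 * x))) = ennreal (exp (- t * x))"
        by (simp add: ennreal_mult[symmetric] exp_add[symmetric] algebra_simps)
      have *: "ennreal (exp (- t * s)) * (ennreal (exp (- t * (- s + 1 * x))) * K (- s + 1 * x) * indicator {0..} (- s + 1 * x))
          = ennreal (exp (- t * x)) * K (x - s) * indicator {s..} x"
        unfolding mult.assoc[symmetric] e by (simp split: split_indicator)
      consider "x \<ge> 0" | "x < s" | "x < 0" "s \<le> x" by linarith
      then show "ennreal (exp (- t * s)) * (ennreal (exp (- t * (- s + 1 * x))) * K (- s + 1 * x) * indicator {0..} (- s + 1 * x))
          \<le> ennreal (exp (- t * x)) * K (x - s) * indicator {0..} x
        + ennreal (exp ((\<theta> + 1) * c) * k c) * indicator {- c..0} x"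
        unfolding *
      proof cases
        case 3
        have "t * - x \<le> (\<theta> + 1) * c" using t 3 s c \<theta>0 by (intro mult_mono) auto
        then have "exp (- t * x) * k (x - s) \<le> exp ((\<theta> + 1) * c) * k c"
          using 3 s k0[THEN less_imp_le] by (intro mult_mono k_mono) auto
        then show "ennreal (exp (- t * x)) * K (x - s) * indicator {s..} x \<le> ennreal (exp (- t * x)) * K (x - s) * indicator {0..} x
          + ennreal (exp ((\<theta> + 1) * c) * k c) * indicator {- c..0} x"
          using 3 s k0[of "x - s"] unfolding Kk by (simp add: ennreal_mult[symmetric] ennreal_leI)
      qed (auto split: split_indicator simp: add_increasing2)
    qed
    also have "\<dots> = (\<integral>\<^sup>+ x. ennreal (exp (- t * x)) * K (x - s) * indicator {0..} x \<partial>lborel) + ennreal C"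
      using c k0[of c] by (subst nn_integral_add) (simp_all add: nn_integral_cmult C_def ennreal_mult)
    finally show ?thesis .
  qed
  have "\<phi> * l = (\<integral>\<^sup>+ s. ennreal (exp (- t * s)) * l \<partial>Q)"
    unfolding \<phi>_def by (subst nn_integral_multc) auto
  also have "\<dots> \<le> (\<integral>\<^sup>+ s. (\<integral>\<^sup>+ x. ennreal (exp (- t * x)) * K (x - s) * indicator {0..} x \<partial>lborel) + ennreal C \<partial>Q)"
    by (intro nn_integral_mono_AE eventually_mono[OF c(2)] step)
  also have "\<dots> = (\<integral>\<^sup>+ s. (\<integral>\<^sup>+ x. ennreal (exp (- t * x)) * K (x - s) * indicator {0..} x \<partial>lborel) \<partial>Q) + ennreal C * ennreal m"
    by (subst nn_integral_add) (auto simp: m)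
  also have "(\<integral>\<^sup>+ s. (\<integral>\<^sup>+ x. ennreal (exp (- t * x)) * K (x - s) * indicator {0..} x \<partial>lborel) \<partial>Q)
      = (\<integral>\<^sup>+ x. (\<integral>\<^sup>+ s. ennreal (exp (- t * x)) * K (x - s) * indicator {0..} x \<partial>Q) \<partial>lborel)"
  proof -
    interpret P: pair_sigma_finite lborel Q ..
    show ?thesis by (rule P.Fubini') measurable
  qed
  also have "\<dots> = l" unfolding l_def
  proof (intro nn_integral_cong)
    fix x :: real
    have "(\<integral>\<^sup>+ s. ennreal (exp (- t * x)) * K (x - s) * indicator {0..} x \<partial>Q)
        = ennreal (exp (- t * x)) * (\<integral>\<^sup>+ s. K (x - s) \<partial>Q) * indicator {0..} x"
      by (simp add: nn_integral_cmult nn_integral_multc)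
    then show "(\<integral>\<^sup>+ s. ennreal (exp (- t * x)) * K (x - s) * indicator {0..} x \<partial>Q)
        = ennreal (exp (- t * x)) * K x * indicator {0..} x"
      by (auto simp: K_eq[of x, symmetric] split: split_indicator)
  qed
  finally have main: "\<phi> * l \<le> l + ennreal (C * m)" using C0 m by (simp add: ennreal_mult)
  obtain l' where l': "l = ennreal l'" "l' \<ge> 0" using l_fin by (cases l) auto
  have "1 / \<delta> \<le> l'" using l_ge l' by (simp add: ennreal_le_iff)
  then have l'_pos: "l' > 0" and "1 \<le> \<delta> * l'" using \<delta> by (auto simp: field_simps intro: less_le_trans[of _ "1/\<delta>"])
  have "\<phi> \<noteq> \<infinity>" using main l' l'_pos by (auto simp: ennreal_top_mult ennreal_plus[symmetric] top_unique C0 m(2) simp del: ennreal_plus)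
  then obtain p where p: "\<phi> = ennreal p" "p \<ge> 0" by (cases \<phi>) auto
  have "p * l' \<le> l' + C * m" using main p l' Cm by (simp add: ennreal_mult[symmetric] ennreal_plus[symmetric] ennreal_le_iff del: ennreal_plus)
  also have "C * m \<le> C * m * (\<delta> * l')" using Cm \<open>1 \<le> \<delta> * l'\<close> mult_left_mono[of 1 "\<delta> * l'" "C * m"] by simp
  also have "\<dots> \<le> \<epsilon> * l'" using mult_right_mono[OF \<delta>2, of l'] l' by (simp add: mult.assoc)
  finally have "p * l' \<le> (1 + \<epsilon>) * l'" by (simp add: algebra_simps)
  then have "p \<le> 1 + \<epsilon>" using l'_pos by simp
  then have "\<phi> \<le> ennreal (1 + \<epsilon>)" unfolding p by (rule ennreal_leI)
  then show ?thesis using t(2) unfolding \<phi>_def by blast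
qed

end

section \<open>The recursion for the number of visits\<close>

text \<open>On {X < 0} the integrand grows with the exponent, so bounded integrals keep the
  exponents in a compact interval; along a convergent subsequence Fatou's lemma gives the bound for
  the limit. With constant \<open>A\<close> this shows that an infimum is attained, with growing
  \<open>A\<close> it removes a truncation.\<close>

lemma (in finite_measure) ex_exp_integral_le:
  fixes X :: "'a \<Rightarrow> real" and A :: "nat \<Rightarrow> 'a set" and t :: "nat \<Rightarrow> real" and c :: real
  assumes [measurable]: "X \<in> borel_measurable M" "\<And>n. A n \<in> sets M"
    and A: "incseq A" "(\<Union>n. A n) = space M"
    and pos: "emeasure M {\<omega> \<in> space M. X \<omega> < 0} > 0"
    and t: "\<And>n. t n \<ge> 0" and c: "c \<ge> 0"
    and le: "\<And>n. (\<integral>\<^sup>+ \<omega>. ennreal (exp (- t n * X \<omega>)) * indicator (A n) \<omega> \<partial>M) \<le> ennreal (c + 1 / Suc n)"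
  shows "\<exists>\<theta>\<ge>0. (\<integral>\<^sup>+ \<omega>. ennreal (exp (- \<theta> * X \<omega>)) \<partial>M) \<le> ennreal c"
proof -
  \<comment> \<open>On \<open>B n\<close> the integrand exp(-t X) is at least exp(t / (n+1)). These
    sets exhaust {X < 0}, so one of them has positive measure.\<close>
  define B where "B n = {\<omega> \<in> A n. X \<omega> \<le> - 1 / Suc n}" for n
  have B_eq: "B n = A n \<inter> {\<omega> \<in> space M. X \<omega> \<le> - 1 / Suc n}" for n
    unfolding B_def using sets.sets_into_space[of "A n" M] by auto
  have [measurable]: "B n \<in> sets M" for n unfolding B_eq by measurable
  have B_inc: "incseq B"
  proof (rule incseq_SucI)
    fix n show "B n \<le> B (Suc n)"
      using incseq_SucD[OF A(1), of n] divide_left_mono[of "real (Suc n)" "real (Suc (Suc n))" 1]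
      by (force simp: B_def)
  qed
  have B_Un: "(\<Union>n. B n) = {\<omega> \<in> space M. X \<omega> < 0}"
  proof (intro equalityI subsetI)
    fix \<omega> assume \<omega>: "\<omega> \<in> {\<omega> \<in> space M. X \<omega> < 0}"
    then obtain n where n: "\<omega> \<in> A n" using A(2) by auto
    obtain k where k: "1 / Suc k < - X \<omega>" using \<omega> nat_approx_posE[of "- X \<omega>"] by auto
    have "1 / Suc (max n k) \<le> 1 / Suc k" by (simp add: field_simps)
    then have "\<omega> \<in> B (max n k)" using n k incseqD[OF A(1), of n "max n k"] unfolding B_def by force
    then show "\<omega> \<in> (\<Union>n. B n)" by blast
  next
    fix \<omega> assume "\<omega> \<in> (\<Union>n. B n)"
    then obtain n where "\<omega> \<in> B n" by blast
    moreover have "- 1 / Suc n < (0::real)" by simp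
    ultimately show "\<omega> \<in> {\<omega> \<in> space M. X \<omega> < 0}" unfolding B_eq by (auto intro: le_less_trans)
  qed
  have "(\<lambda>n. emeasure M (B n)) \<longlonglongrightarrow> emeasure M {\<omega> \<in> space M. X \<omega> < 0}"
    unfolding B_Un[symmetric] by (intro Lim_emeasure_incseq B_inc) auto
  then have "eventually (\<lambda>n. emeasure M (B n) > 0) sequentially"
    using pos by (rule order_tendstoD(1))
  then obtain N where "emeasure M (B N) > 0" by (auto simp: eventually_sequentially)
  then have p: "measure M (B N) > 0" by (simp add: emeasure_eq_measure)
  \<comment> \<open>Comes from exp(u) * measure M (B N) \<le> c + 1 with u = t / (N+1), together
    with u \<le> exp(u). The shift of the index by \<open>N\<close> ensures that the set of
    integration contains \<open>B N\<close>.\<close>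
  define b where "b = (c + 1) / measure M (B N) * Suc N"
  have bd: "t (n + N) \<in> {0..b}" for n
  proof -
    have "ennreal (exp (t (n + N) / Suc N) * measure M (B N))
        = (\<integral>\<^sup>+ \<omega>. ennreal (exp (t (n + N) / Suc N)) * indicator (B N) \<omega> \<partial>M)"
      by (subst nn_integral_cmult_indicator) (simp_all add: emeasure_eq_measure ennreal_mult)
    also have "\<dots> \<le> (\<integral>\<^sup>+ \<omega>. ennreal (exp (- t (n + N) * X \<omega>)) * indicator (A (n + N)) \<omega> \<partial>M)"
    proof (intro nn_integral_mono)
      fix \<omega>
      show "ennreal (exp (t (n + N) / Suc N)) * indicator (B N) \<omega> \<le> ennreal (exp (- t (n + N) * X \<omega>)) * indicator (A (n + N)) \<omega>"
      proof (cases "\<omega> \<in> B N")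
        case True
        then have "\<omega> \<in> A (n + N)" using incseqD[OF A(1), of N "n + N"] by (auto simp: B_def)
        moreover have "t (n + N) * (1 / Suc N) \<le> t (n + N) * - X \<omega>"
          using True t[of "n + N"] by (intro mult_left_mono) (auto simp: B_def)
        ultimately show ?thesis using True by (auto intro!: ennreal_leI)
      qed simp
    qed
    also have "\<dots> \<le> ennreal (c + 1 / Suc (n + N))" by (rule le)
    also have "\<dots> \<le> ennreal (c + 1)" by (intro ennreal_leI) (simp add: field_simps)
    finally have "exp (t (n + N) / Suc N) * measure M (B N) \<le> c + 1"
      using c by (subst (asm) ennreal_le_iff) auto
    then have "exp (t (n + N) / Suc N) \<le> (c + 1) / measure M (B N)"
      using p by (simp add: field_simps)
    then have "t (n + N) / Suc N \<le> (c + 1) / measure M (B N)"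
      using exp_ge_add_one_self[of "t (n + N) / Suc N"] by linarith
    then have "t (n + N) \<le> b" unfolding b_def by (simp only: pos_divide_le_eq of_nat_0_less_iff zero_less_Suc)
    then show ?thesis using t[of "n + N"] by simp
  qed
  obtain \<theta> r where \<theta>: "\<theta> \<in> {0..b}" and r: "strict_mono r" and lim: "((\<lambda>n. t (n + N)) \<circ> r) \<longlonglongrightarrow> \<theta>"
    using compact_Icc[of 0 b] bd unfolding compact_def by (metis (no_types, lifting))
  have "(\<integral>\<^sup>+ \<omega>. ennreal (exp (- \<theta> * X \<omega>)) \<partial>M)
      = (\<integral>\<^sup>+ \<omega>. liminf (\<lambda>n. ennreal (exp (- t (r n + N) * X \<omega>)) * indicator (A (r n + N)) \<omega>) \<partial>M)"
  proof (intro nn_integral_cong)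
    fix \<omega> assume "\<omega> \<in> space M"
    then obtain m where m: "\<omega> \<in> A m" using A(2) by auto
    have "(\<lambda>n. ennreal (exp (- t (r n + N) * X \<omega>))) \<longlonglongrightarrow> ennreal (exp (- \<theta> * X \<omega>))"
      using lim by (intro tendsto_ennrealI tendsto_intros) (simp add: o_def)
    moreover have "eventually (\<lambda>n. ennreal (exp (- t (r n + N) * X \<omega>)) = ennreal (exp (- t (r n + N) * X \<omega>)) * indicator (A (r n + N)) \<omega>) sequentially"
      using eventually_ge_at_top[of m]
    proof eventually_elim
      case (elim n)
      have "m \<le> r n + N" using elim seq_suble[OF r, of n] by linarith
      then have "\<omega> \<in> A (r n + N)" using incseqD[OF A(1)] m by blast
      then show ?case by simp
    qed
    ultimately have "(\<lambda>n. ennreal (exp (- t (r n + N) * X \<omega>)) * indicator (A (r n + N)) \<omega>) \<longlonglongrightarrow> ennreal (exp (- \<theta> * X \<omega>))"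
      by (rule Lim_transform_eventually)
    then show "ennreal (exp (- \<theta> * X \<omega>)) = liminf (\<lambda>n. ennreal (exp (- t (r n + N) * X \<omega>)) * indicator (A (r n + N)) \<omega>)"
      by (intro lim_imp_Liminf[symmetric]) auto
  qed
  also have "\<dots> \<le> liminf (\<lambda>n. (\<integral>\<^sup>+ \<omega>. ennreal (exp (- t (r n + N) * X \<omega>)) * indicator (A (r n + N)) \<omega> \<partial>M))"
    by (intro nn_integral_liminf) measurable
  also have "\<dots> \<le> liminf (\<lambda>n. ennreal (c + 1 / Suc (r n + N)))"
    by (intro Liminf_mono always_eventually allI le)
  also have "\<dots> = ennreal c"
  proof (intro lim_imp_Liminf)
    have "(\<lambda>n. c + 1 / Suc (r n + N)) \<longlonglongrightarrow> c + 0"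
    proof (intro tendsto_intros)
      have "filterlim (\<lambda>n. r n + N) at_top sequentially"
        using filterlim_subseq[OF r] by (rule filterlim_at_top_mono) auto
      then show "(\<lambda>n. 1 / Suc (r n + N)) \<longlonglongrightarrow> 0"
        using LIMSEQ_inverse_real_of_nat unfolding inverse_eq_divide by (rule filterlim_compose[rotated])
    qed
    then show "(\<lambda>n. ennreal (c + 1 / Suc (r n + N))) \<longlonglongrightarrow> ennreal c" by (intro tendsto_ennrealI) simp
  qed simp
  finally show ?thesis using \<theta> by auto
qed

text \<open>Conditioning on the first pair turns the exponential moment of the number of visits among the
  first \<open>n\<close> times into a recursion in the level \<open>x\<close>.\<close>

primrec visit_moment :: "(real \<times> real) measure \<Rightarrow> real \<Rightarrow> nat \<Rightarrow> real \<Rightarrow> ennreal" where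
  "visit_moment \<mu> a 0 = (\<lambda>x. 1)"
| "visit_moment \<mu> a (Suc n) = (\<lambda>x. \<integral>\<^sup>+ z. ennreal (exp (if snd z \<le> x then a else 0)) * visit_moment \<mu> a n (x - fst z) \<partial>\<mu>)"

locale step_law = prob_space \<mu> for \<mu> :: "(real \<times> real) measure" +
  fixes a :: real
  assumes sets_\<mu> [measurable_cong]: "sets \<mu> = sets (borel \<Otimes>\<^sub>M borel)"
    and a_pos: "a > 0"
begin

lemma space_\<mu> [simp]: "space \<mu> = UNIV"
  using sets_eq_imp_space_eq[OF sets_\<mu>] by (simp add: space_pair_measure)

lemma events_Collect: "Measurable.pred (borel \<Otimes>\<^sub>M borel) P \<Longrightarrow> {z. P z} \<in> sets \<mu>"
  by (simp add: sets_\<mu> pred_def space_pair_measure)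

lemma visit_moment_measurable [measurable]: "visit_moment \<mu> a n \<in> borel_measurable borel"
proof (induction n)
  case (Suc n)
  note Suc [measurable]
  show ?case by simp
qed simp

lemma weight_ge_1: "1 \<le> ennreal (exp (if P then a else 0))"
  using a_pos by (simp add: ennreal_1[symmetric] ennreal_leI del: ennreal_1)

lemma weight_le: "ennreal (exp (if P then a else 0)) \<le> ennreal (exp a)"
  using a_pos by (intro ennreal_leI) simp

lemma weight_mono: "(x::real) \<le> y \<Longrightarrow> ennreal (exp (if t \<le> x then a else 0)) \<le> ennreal (exp (if t \<le> y then a else 0))"
  using a_pos by (intro ennreal_leI) auto

lemma visit_moment_ge_1: "1 \<le> visit_moment \<mu> a n x"
proof (induction n arbitrary: x)
  case (Suc n)
  have "1 = (\<integral>\<^sup>+ z. 1 * 1 \<partial>\<mu>)" using emeasure_space_1 by simp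
  also have "\<dots> \<le> (\<integral>\<^sup>+ z. ennreal (exp (if snd z \<le> x then a else 0)) * visit_moment \<mu> a n (x - fst z) \<partial>\<mu>)"
    by (intro nn_integral_mono mult_mono weight_ge_1 Suc) auto
  finally show ?case by simp
qed simp

lemma visit_moment_mono: "x \<le> y \<Longrightarrow> visit_moment \<mu> a n x \<le> visit_moment \<mu> a n y"
proof (induction n arbitrary: x y)
  case (Suc n)
  then show ?case by (auto intro!: nn_integral_mono mult_mono weight_mono Suc.IH simp del: ennreal_le_iff)
qed simp

lemma visit_moment_Suc_ge: "visit_moment \<mu> a n x \<le> visit_moment \<mu> a (Suc n) x"
proof (induction n arbitrary: x)
  case 0
  show ?case using visit_moment_ge_1[of "Suc 0" x] by simp
next
  case (Suc n)
  have "visit_moment \<mu> a (Suc n) x = (\<integral>\<^sup>+ z. ennreal (exp (if snd z \<le> x then a else 0)) * visit_moment \<mu> a n (x - fst z) \<partial>\<mu>)" by simp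
  also have "\<dots> \<le> (\<integral>\<^sup>+ z. ennreal (exp (if snd z \<le> x then a else 0)) * visit_moment \<mu> a (Suc n) (x - fst z) \<partial>\<mu>)"
    by (intro nn_integral_mono mult_left_mono Suc) auto
  also have "\<dots> = visit_moment \<mu> a (Suc (Suc n)) x" by (simp only: visit_moment.simps)
  finally show ?case .
qed

lemma incseq_visit_moment: "incseq (\<lambda>n. visit_moment \<mu> a n x)"
  by (intro incseq_SucI visit_moment_Suc_ge)

lemma visit_moment_le: "visit_moment \<mu> a n x \<le> ennreal (exp a ^ n)"
proof (induction n arbitrary: x)
  case (Suc n)
  have "visit_moment \<mu> a (Suc n) x \<le> (\<integral>\<^sup>+ z. ennreal (exp a) * ennreal (exp a ^ n) \<partial>\<mu>)"
    unfolding visit_moment.simps by (intro nn_integral_mono mult_mono weight_le Suc) auto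
  then show ?case using emeasure_space_1 by (simp add: ennreal_mult)
qed simp

lemma visit_moment_finite: "visit_moment \<mu> a n x < \<infinity>"
  using visit_moment_le[of n x] by (metis ennreal_less_top infinity_ennreal_def le_less_trans)

text \<open>This is E exp(a N(x)) in [0, \<infinity>]. The truncated moments are all finite, so only
  the limit can be infinite.\<close>

definition full_moment :: "real \<Rightarrow> ennreal" where
  "full_moment x = (SUP n. visit_moment \<mu> a n x)"

lemma full_moment_measurable [measurable]: "full_moment \<in> borel_measurable borel"
  unfolding full_moment_def by measurable

lemma visit_moment_le_full_moment: "visit_moment \<mu> a n x \<le> full_moment x"
  unfolding full_moment_def by (rule SUP_upper) simp

lemma full_moment_ge_1: "1 \<le> full_moment x"
  using visit_moment_ge_1 visit_moment_le_full_moment order_trans by blast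

lemma full_moment_mono: "x \<le> y \<Longrightarrow> full_moment x \<le> full_moment y"
  unfolding full_moment_def by (intro SUP_mono) (auto intro: visit_moment_mono)

lemma full_moment_eq: "full_moment x = (\<integral>\<^sup>+ z. ennreal (exp (if snd z \<le> x then a else 0)) * full_moment (x - fst z) \<partial>\<mu>)"
proof -
  have "(\<integral>\<^sup>+ z. ennreal (exp (if snd z \<le> x then a else 0)) * full_moment (x - fst z) \<partial>\<mu>)
     = (\<integral>\<^sup>+ z. (SUP n. ennreal (exp (if snd z \<le> x then a else 0)) * visit_moment \<mu> a n (x - fst z)) \<partial>\<mu>)"
    unfolding full_moment_def by (subst SUP_mult_left_ennreal) auto
  also have "\<dots> = (SUP n. visit_moment \<mu> a (Suc n) x)"
    unfolding visit_moment.simps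
    by (rule nn_integral_monotone_convergence_SUP)
       (auto simp: incseq_Suc_iff le_fun_def simp del: visit_moment.simps intro!: mult_left_mono visit_moment_Suc_ge)
  also have "\<dots> = full_moment x" unfolding full_moment_def using visit_moment_Suc_ge[of _ x]
    by (intro antisym SUP_mono) (auto simp del: visit_moment.simps)
  finally show ?thesis by simp
qed

text \<open>A first step of at most -\<epsilon> raises the remaining level by at least \<epsilon>,
  so the one-step equation bounds P{\<xi> \<le> -\<epsilon>} times the moment at y + \<epsilon> by
  the moment at y; repeating this reaches every level.\<close>

lemma full_moment_finite_all:
  assumes neg: "emeasure \<mu> {z. fst z < 0} > 0" and fin: "full_moment x < \<infinity>"
  shows "full_moment y < \<infinity>"
proof -
  have "\<exists>\<epsilon>>0. emeasure \<mu> {z. fst z \<le> - \<epsilon>} > 0"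
  proof (rule ccontr)
    assume "\<not> ?thesis"
    then have *: "emeasure \<mu> {z. fst z \<le> - \<epsilon>} = 0" if "\<epsilon> > 0" for \<epsilon>
      using that by (metis not_gr_zero)
    have "AE z in \<mu>. \<forall>n::nat. \<not> fst z \<le> - (1 / Suc n)"
      unfolding AE_all_countable
    proof
      fix n :: nat
      show "AE z in \<mu>. \<not> fst z \<le> - (1 / Suc n)"
        by (rule AE_I[OF _ *[of "1 / Suc n"]]) (auto intro!: events_Collect simp: not_le)
    qed
    then have "AE z in \<mu>. \<not> fst z < 0"
    proof eventually_elim
      case (elim z)
      show ?case
      proof
        assume "fst z < 0"
        then obtain n where "1 / Suc n < - fst z" using nat_approx_posE[of "- fst z"] by auto
        then show False using elim[rule_format, of n] by simp
      qed
    qed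
    then have "emeasure \<mu> {z. fst z < 0} = 0" by (subst (asm) AE_iff_measurable[OF _ refl]) (auto intro: events_Collect)
    then show False using neg by simp
  qed
  then obtain \<epsilon> where \<epsilon>: "\<epsilon> > 0" "emeasure \<mu> {z. fst z \<le> - \<epsilon>} > 0" by blast
  have up: "full_moment (y + \<epsilon>) < \<infinity>" if "full_moment y < \<infinity>" for y
  proof -
    have "full_moment (y + \<epsilon>) * emeasure \<mu> {z. fst z \<le> - \<epsilon>} = (\<integral>\<^sup>+ z. full_moment (y + \<epsilon>) * indicator {z. fst z \<le> - \<epsilon>} z \<partial>\<mu>)"
      by (subst nn_integral_cmult_indicator) (auto intro: events_Collect)
    also have "\<dots> \<le> (\<integral>\<^sup>+ z. ennreal (exp (if snd z \<le> y then a else 0)) * full_moment (y - fst z) \<partial>\<mu>)"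
    proof (intro nn_integral_mono)
      fix z :: "real \<times> real"
      have "full_moment (y + \<epsilon>) \<le> full_moment (y - fst z)" if "fst z \<le> - \<epsilon>" using that by (intro full_moment_mono) simp
      then have "1 * full_moment (y + \<epsilon>) \<le> ennreal (exp (if snd z \<le> y then a else 0)) * full_moment (y - fst z)" if "fst z \<le> - \<epsilon>"
        using that by (intro mult_mono weight_ge_1) auto
      then show "full_moment (y + \<epsilon>) * indicator {z. fst z \<le> - \<epsilon>} z \<le> ennreal (exp (if snd z \<le> y then a else 0)) * full_moment (y - fst z)"
        by (auto split: split_indicator)
    qed
    also have "\<dots> = full_moment y" by (rule full_moment_eq[symmetric])
    finally have "full_moment (y + \<epsilon>) * emeasure \<mu> {z. fst z \<le> - \<epsilon>} < \<infinity>" using that by (rule le_less_trans)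
    then show ?thesis using \<epsilon>(2) by (auto simp: ennreal_mult_less_top less_top)
  qed
  have "full_moment (x + real n * \<epsilon>) < \<infinity>" for n
  proof (induction n)
    case (Suc n)
    then show ?case using up[of "x + real n * \<epsilon>"] by (simp add: algebra_simps)
  qed (use fin in simp)
  moreover obtain n where "y - x < real n * \<epsilon>" using \<epsilon>(1) reals_Archimedean3 by blast
  then have "full_moment y \<le> full_moment (x + real n * \<epsilon>)" by (intro full_moment_mono) simp
  ultimately show ?thesis by (meson le_less_trans)
qed

end

section \<open>Finiteness for some level\<close>

text \<open>Coordinate \<open>i\<close> of a path stands for the pair with index i + 1. Hence
  \<open>seq_walk k \<omega>\<close> is S_k, and
  \<open>seq_walk k \<omega> + snd (\<omega> k)\<close> is T_(k+1).\<close>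

definition seq_walk :: "nat \<Rightarrow> (nat \<Rightarrow> real \<times> real) \<Rightarrow> real" where
  "seq_walk n \<omega> = (\<Sum>i<n. fst (\<omega> i))"

definition seq_count :: "nat \<Rightarrow> real \<Rightarrow> (nat \<Rightarrow> real \<times> real) \<Rightarrow> nat" where
  "seq_count n x \<omega> = (\<Sum>k<n. if seq_walk k \<omega> + snd (\<omega> k) \<le> x then 1 else 0)"

text \<open>The value of \<open>g\<close> at the level left over after the step belonging to the
  first visit, or 0 if there is none among the first \<open>k\<close> times. Shifting path and level
  together gives its expectation the same kind of recursion as \<open>visit_moment\<close>.\<close>

primrec first_visit :: "(real \<Rightarrow> ennreal) \<Rightarrow> nat \<Rightarrow> real \<Rightarrow> (nat \<Rightarrow> real \<times> real) \<Rightarrow> ennreal" where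
  "first_visit g 0 y \<omega> = 0"
| "first_visit g (Suc k) y \<omega> =
     (if snd (\<omega> 0) \<le> y then g (y - fst (\<omega> 0)) else first_visit g k (y - fst (\<omega> 0)) (\<lambda>i. \<omega> (Suc i)))"

lemma seq_walk_0 [simp]: "seq_walk 0 \<omega> = 0"
  by (simp add: seq_walk_def)

lemma seq_walk_Suc: "seq_walk (Suc n) \<omega> = fst (\<omega> 0) + seq_walk n (\<lambda>i. \<omega> (Suc i))"
  unfolding seq_walk_def by (rule sum.lessThan_Suc_shift)

lemma seq_count_Suc:
  "seq_count (Suc n) x \<omega> = (if snd (\<omega> 0) \<le> x then 1 else 0) + seq_count n (x - fst (\<omega> 0)) (\<lambda>i. \<omega> (Suc i))"
  unfolding seq_count_def by (subst sum.lessThan_Suc_shift) (simp add: seq_walk_Suc algebra_simps)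

text \<open>The bound is free of \<open>k\<close> and separates the size of \<open>g\<close> from
  the event of a visit. If \<open>g\<close> is translated along with \<open>y\<close>, the supremum
  stays fixed while the event shrinks as y \<rightarrow> -\<infinity>, so dominated convergence
  applies.\<close>

lemma first_visit_le:
  "first_visit g k y \<omega> \<le> (SUP n. g (y - seq_walk n \<omega>)) * indicator {\<omega>. \<exists>n. seq_walk n \<omega> + snd (\<omega> n) \<le> y} \<omega>"
proof (induction k arbitrary: y \<omega>)
  case (Suc k)
  show ?case
  proof (cases "snd (\<omega> 0) \<le> y")
    case True
    then have "\<exists>n. seq_walk n \<omega> + snd (\<omega> n) \<le> y" by (intro exI[of _ 0]) simp
    moreover have "g (y - fst (\<omega> 0)) \<le> (SUP n. g (y - seq_walk n \<omega>))"
      by (rule SUP_upper2[of 1]) (auto simp: seq_walk_def)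
    ultimately show ?thesis using True by simp
  next
    case False
    let ?\<omega> = "\<lambda>i. \<omega> (Suc i)"
    have "first_visit g (Suc k) y \<omega> = first_visit g k (y - fst (\<omega> 0)) ?\<omega>" using False by simp
    also have "\<dots> \<le> (SUP n. g (y - fst (\<omega> 0) - seq_walk n ?\<omega>))
        * indicator {\<omega>'. \<exists>n. seq_walk n \<omega>' + snd (\<omega>' n) \<le> y - fst (\<omega> 0)} ?\<omega>" by (rule Suc)
    also have "\<dots> \<le> (SUP n. g (y - seq_walk n \<omega>)) * indicator {\<omega>. \<exists>n. seq_walk n \<omega> + snd (\<omega> n) \<le> y} \<omega>"
    proof (intro mult_mono)
      show "(SUP n. g (y - fst (\<omega> 0) - seq_walk n ?\<omega>)) \<le> (SUP n. g (y - seq_walk n \<omega>))"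
        by (rule SUP_mono) (metis UNIV_I diff_diff_eq order_refl seq_walk_Suc)
      show "(indicator {\<omega>'. \<exists>n. seq_walk n \<omega>' + snd (\<omega>' n) \<le> y - fst (\<omega> 0)} ?\<omega> :: ennreal)
          \<le> indicator {\<omega>. \<exists>n. seq_walk n \<omega> + snd (\<omega> n) \<le> y} \<omega>"
      proof (cases "\<exists>n. seq_walk n ?\<omega> + snd (?\<omega> n) \<le> y - fst (\<omega> 0)")
        case True
        then obtain n where "seq_walk n ?\<omega> + snd (?\<omega> n) \<le> y - fst (\<omega> 0)" by blast
        then have "seq_walk (Suc n) \<omega> + snd (\<omega> (Suc n)) \<le> y" by (simp add: seq_walk_Suc)
        then show ?thesis by (auto simp: indicator_def)
      qed (simp add: indicator_def)
    qed auto
    finally show ?thesis .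
  qed
qed simp

section \<open>Path space of i.i.d. pairs\<close>

context step_law
begin

abbreviation path_space :: "(nat \<Rightarrow> real \<times> real) measure" where
  "path_space \<equiv> (\<Pi>\<^sub>M i\<in>UNIV::nat set. \<mu>)"

lemma sequence_space: "sequence_space \<mu>"
  unfolding sequence_space_def product_prob_space_def product_prob_space_axioms_def product_sigma_finite_def
  using prob_space_axioms prob_space_imp_sigma_finite by auto

lemma prob_space_path: "prob_space path_space"
  by (rule prob_space_PiM) (rule prob_space_axioms)

text \<open>The path without its first pair is again distributed as \<open>path_space\<close> and
  independent of that pair: the Markov property in the form used throughout.\<close>

lemma nn_integral_path:
  assumes [measurable]: "f \<in> borel_measurable path_space"
  shows "(\<integral>\<^sup>+ \<omega>. f \<omega> \<partial>path_space) = (\<integral>\<^sup>+ z. (\<integral>\<^sup>+ \<omega>. f (case_nat z \<omega>) \<partial>path_space) \<partial>\<mu>)"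
proof -
  interpret S: sequence_space \<mu> by (rule sequence_space)
  have "(\<integral>\<^sup>+ \<omega>. f \<omega> \<partial>path_space)
      = (\<integral>\<^sup>+ \<omega>. f \<omega> \<partial>distr (\<mu> \<Otimes>\<^sub>M path_space) path_space (\<lambda>(s, \<omega>). case_nat s \<omega>))"
    by (simp only: S.PiM_iter)
  also have "\<dots> = (\<integral>\<^sup>+ p. f (case_nat (fst p) (snd p)) \<partial>(\<mu> \<Otimes>\<^sub>M path_space))"
    by (subst nn_integral_distr) (auto simp: split_beta')
  also have "\<dots> = (\<integral>\<^sup>+ z. (\<integral>\<^sup>+ \<omega>. f (case_nat z \<omega>) \<partial>path_space) \<partial>\<mu>)"
    by (subst sigma_finite_measure.nn_integral_fst[OF prob_space_imp_sigma_finite[OF prob_space_path], symmetric]) auto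
  finally show ?thesis .
qed

lemma measurable_component [measurable]: "(\<lambda>\<omega>. \<omega> i) \<in> measurable path_space \<mu>"
  by (rule measurable_component_singleton) simp

lemma measurable_shift [measurable]: "(\<lambda>\<omega> i. \<omega> (Suc i)) \<in> measurable path_space path_space"
  by (rule measurable_PiM_single') (auto simp: space_PiM)

lemma measurable_fst_component [measurable]: "(\<lambda>\<omega>. fst (\<omega> i)) \<in> borel_measurable path_space"
  and measurable_snd_component [measurable]: "(\<lambda>\<omega>. snd (\<omega> i)) \<in> borel_measurable path_space"
proof -
  have "(\<lambda>\<omega>. \<omega> i) \<in> measurable path_space (borel \<Otimes>\<^sub>M borel)"
    using measurable_component measurable_cong_sets[OF refl sets_\<mu>] by blast
  then show "(\<lambda>\<omega>. fst (\<omega> i)) \<in> borel_measurable path_space" "(\<lambda>\<omega>. snd (\<omega> i)) \<in> borel_measurable path_space"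
    by measurable
qed

lemma measurable_seq_walk [measurable]: "seq_walk n \<in> borel_measurable path_space"
  unfolding seq_walk_def by measurable

lemma measurable_seq_count [measurable]: "seq_count n x \<in> measurable path_space (count_space UNIV)"
  unfolding seq_count_def by measurable

text \<open>Joint measurability is needed because the recursion moves level and path at once, and
  because the expectation is integrated as a function of the level.\<close>

lemma measurable_first_visit [measurable]:
  assumes [measurable]: "g \<in> borel_measurable borel"
  shows "(\<lambda>p. first_visit g k (fst p) (snd p)) \<in> borel_measurable (borel \<Otimes>\<^sub>M path_space)"
proof (induction k)
  case (Suc k)
  have "(\<lambda>p. (fst p - fst (snd p 0), \<lambda>i. snd p (Suc i))) \<in> measurable (borel \<Otimes>\<^sub>M path_space) (borel \<Otimes>\<^sub>M path_space)"
  proof (rule measurable_Pair)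
    show "(\<lambda>p. fst p - fst (snd p 0)) \<in> borel_measurable (borel \<Otimes>\<^sub>M path_space)" by measurable
    show "(\<lambda>p i. snd p (Suc i)) \<in> measurable (borel \<Otimes>\<^sub>M path_space) path_space"
      by (rule measurable_compose[OF measurable_snd measurable_shift])
  qed
  from measurable_compose[OF this Suc]
  have [measurable]: "(\<lambda>p. first_visit g k (fst p - fst (snd p 0)) (\<lambda>i. snd p (Suc i))) \<in> borel_measurable (borel \<Otimes>\<^sub>M path_space)"
    by simp
  show ?case unfolding first_visit.simps by measurable
qed simp

lemma measurable_first_visit' [measurable]:
  assumes "g \<in> borel_measurable borel"
  shows "first_visit g k y \<in> borel_measurable path_space"
  using measurable_compose[OF measurable_Pair1' measurable_first_visit[OF assms], of y k] by simp

lemma visit_moment_eq: "visit_moment \<mu> a n x = (\<integral>\<^sup>+ \<omega>. ennreal (exp (a * real (seq_count n x \<omega>))) \<partial>path_space)"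
proof (induction n arbitrary: x)
  case 0
  interpret P: prob_space path_space by (rule prob_space_path)
  show ?case using P.emeasure_space_1 by (simp add: seq_count_def)
next
  case (Suc n)
  have "(\<integral>\<^sup>+ \<omega>. ennreal (exp (a * real (seq_count (Suc n) x \<omega>))) \<partial>path_space)
     = (\<integral>\<^sup>+ z. (\<integral>\<^sup>+ \<omega>. ennreal (exp (a * real (seq_count (Suc n) x (case_nat z \<omega>)))) \<partial>path_space) \<partial>\<mu>)"
    by (rule nn_integral_path) measurable
  also have "\<dots> = (\<integral>\<^sup>+ z. (\<integral>\<^sup>+ \<omega>. ennreal (exp (if snd z \<le> x then a else 0)) * ennreal (exp (a * real (seq_count n (x - fst z) \<omega>))) \<partial>path_space) \<partial>\<mu>)"
    by (intro nn_integral_cong)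
       (simp add: seq_count_Suc ennreal_mult[symmetric] exp_add[symmetric] distrib_left)
  also have "\<dots> = visit_moment \<mu> a (Suc n) x"
    by (simp add: nn_integral_cmult Suc)
  finally show ?case by simp
qed

lemma full_moment_eq_path: "full_moment x = (\<integral>\<^sup>+ \<omega>. (SUP n. ennreal (exp (a * real (seq_count n x \<omega>)))) \<partial>path_space)"
  unfolding full_moment_def visit_moment_eq
proof (rule nn_integral_monotone_convergence_SUP[symmetric])
  show "incseq (\<lambda>n \<omega>. ennreal (exp (a * real (seq_count n x \<omega>))))"
    using a_pos by (intro incseq_SucI le_funI ennreal_leI) (simp add: seq_count_def)
qed measurable

text \<open>Stop at the first visit below \<open>x\<close>; if the walk has then moved by \<open>s\<close>, the remaining moment is at
  most \<open>\<kappa> (- s)\<close> times the moment at \<open>x\<close> itself. Since \<open>T\<close> is bounded below, a first visit below \<open>x\<close>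
  becomes unlikely as \<open>x \<rightarrow> - \<infinity>\<close>, so that eventually the moment is at most \<open>1\<close> plus half of itself.\<close>

lemma ex_full_moment_finite:
  assumes \<kappa> [measurable]: "\<kappa> \<in> borel_measurable borel"
    and le: "\<And>n x y. visit_moment \<mu> a n y \<le> \<kappa> (y - x) * visit_moment \<mu> a n x"
    and int: "(\<integral>\<^sup>+ \<omega>. (SUP n. \<kappa> (- seq_walk n \<omega>)) \<partial>path_space) < \<infinity>"
    and bdd: "AE \<omega> in path_space. \<exists>b. \<forall>n. b \<le> seq_walk n \<omega> + snd (\<omega> n)"
  shows "\<exists>x. full_moment x < \<infinity>"
proof -
  interpret P: prob_space path_space by (rule prob_space_path)
  define E where "E y = {\<omega> :: nat \<Rightarrow> real \<times> real. \<exists>n. seq_walk n \<omega> + snd (\<omega> n) \<le> y}" for y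
  define G where "G \<omega> = (SUP n. \<kappa> (- seq_walk n \<omega>))" for \<omega>
  have [measurable]: "G \<in> borel_measurable path_space" unfolding G_def by measurable
  have [measurable]: "(\<lambda>\<omega>. indicator (E y) \<omega> :: ennreal) \<in> borel_measurable path_space" for y
    unfolding E_def indicator_def mem_Collect_eq by measurable
  \<comment> \<open>The integrands decrease in \<open>i\<close> and are dominated by the integrable
    \<open>G\<close>; on a path that is bounded below the indicator is eventually 0.\<close>
  have "(INF i::nat. \<integral>\<^sup>+ \<omega>. G \<omega> * indicator (E (- real i)) \<omega> \<partial>path_space)
      = (\<integral>\<^sup>+ \<omega>. (INF i::nat. G \<omega> * indicator (E (- real i)) \<omega>) \<partial>path_space)"
  proof (rule nn_integral_monotone_convergence_INF_AE[symmetric])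
    show "AE \<omega> in path_space. G \<omega> * indicator (E (- real (Suc i))) \<omega> \<le> G \<omega> * indicator (E (- real i)) \<omega>" for i
    proof (intro AE_I2 mult_left_mono)
      have "E (- real (Suc i)) \<subseteq> E (- real i)" unfolding E_def by (smt (verit) Collect_mono of_nat_Suc)
      then show "indicator (E (- real (Suc i))) \<omega> \<le> (indicator (E (- real i)) \<omega> :: ennreal)" for \<omega>
        by (auto simp: indicator_def)
    qed simp
    have "(\<integral>\<^sup>+ \<omega>. G \<omega> * indicator (E (- real 0)) \<omega> \<partial>path_space) \<le> (\<integral>\<^sup>+ \<omega>. G \<omega> \<partial>path_space)"
      by (intro nn_integral_mono) (auto simp: indicator_def)
    also have "\<dots> < \<infinity>" using int unfolding G_def .
    finally show "(\<integral>\<^sup>+ \<omega>. G \<omega> * indicator (E (- real 0)) \<omega> \<partial>path_space) < \<infinity>" .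
  qed measurable
  also have "\<dots> = (\<integral>\<^sup>+ \<omega>. 0 \<partial>path_space)"
  proof (rule nn_integral_cong_AE)
    show "AE \<omega> in path_space. (INF i::nat. G \<omega> * indicator (E (- real i)) \<omega>) = 0"
      using bdd
    proof eventually_elim
      case (elim \<omega>)
      then obtain b where b: "\<And>n. b \<le> seq_walk n \<omega> + snd (\<omega> n)" by blast
      obtain i :: nat where i: "- b < real i" using reals_Archimedean2 by blast
      have "\<omega> \<notin> E (- real i)"
      proof
        assume "\<omega> \<in> E (- real i)"
        then obtain n where "seq_walk n \<omega> + snd (\<omega> n) \<le> - real i" unfolding E_def by blast
        then show False using b[of n] i by linarith
      qed
      then have "G \<omega> * indicator (E (- real i)) \<omega> = 0" by simp
      then have "(INF i::nat. G \<omega> * indicator (E (- real i)) \<omega>) \<le> 0"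
        by (intro INF_lower2[of i]) auto
      then show ?case by simp
    qed
  qed
  \<comment> \<open>Multiplied by the weight exp(a) of the first visit, this threshold becomes the
    contraction factor 1/2.\<close>
  finally have "(INF i::nat. \<integral>\<^sup>+ \<omega>. G \<omega> * indicator (E (- real i)) \<omega> \<partial>path_space) < ennreal (exp (- a) / 2)"
    by simp
  then obtain i :: nat where i: "(\<integral>\<^sup>+ \<omega>. G \<omega> * indicator (E (- real i)) \<omega> \<partial>path_space) < ennreal (exp (- a) / 2)"
    by (auto simp: INF_less_iff)
  define x where "x = - real i"
  define g where "g d = \<kappa> (d - x)" for d
  have [measurable]: "g \<in> borel_measurable borel" unfolding g_def by measurable
  define D where "D k y = (\<integral>\<^sup>+ \<omega>. first_visit g k y \<omega> \<partial>path_space)" for k y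
  have [measurable]: "D k \<in> borel_measurable borel" for k
    unfolding D_def using P.borel_measurable_nn_integral[of "first_visit g k" borel] measurable_first_visit[of g k]
    by (simp add: split_beta')
  have D_Suc: "D (Suc k) y = (\<integral>\<^sup>+ z. (if snd z \<le> y then g (y - fst z) else D k (y - fst z)) \<partial>\<mu>)" for k y
    unfolding D_def
    by (subst nn_integral_path) (auto intro!: nn_integral_cong simp: P.emeasure_space_1)
  have Dx: "D k x \<le> ennreal (exp (- a) / 2)" for k
  proof -
    have "D k x \<le> (\<integral>\<^sup>+ \<omega>. G \<omega> * indicator (E (- real i)) \<omega> \<partial>path_space)"
      unfolding D_def by (intro nn_integral_mono order_trans[OF first_visit_le]) (simp add: g_def G_def E_def x_def)
    then show ?thesis using i by simp
  qed
  have "visit_moment \<mu> a n x \<le> 2" for n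
  proof -
    define B where "B = visit_moment \<mu> a n x"
    \<comment> \<open>Paths without a visit contribute the factor 1. The first visit costs exp(a),
      and \<open>le\<close> compares what remains with the moment at \<open>x\<close>.\<close>
    have *: "visit_moment \<mu> a k y \<le> 1 + ennreal (exp a) * B * D k y" if "k \<le> n" for k y
      using that
    proof (induction k arbitrary: y)
      case (Suc k)
      have "visit_moment \<mu> a (Suc k) y \<le> (\<integral>\<^sup>+ z. 1 + ennreal (exp a) * B * (if snd z \<le> y then g (y - fst z) else D k (y - fst z)) \<partial>\<mu>)"
        unfolding visit_moment.simps
      proof (intro nn_integral_mono)
        fix z :: "real \<times> real"
        show "ennreal (exp (if snd z \<le> y then a else 0)) * visit_moment \<mu> a k (y - fst z)
            \<le> 1 + ennreal (exp a) * B * (if snd z \<le> y then g (y - fst z) else D k (y - fst z))"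
        proof (cases "snd z \<le> y")
          case True
          have "visit_moment \<mu> a k (y - fst z) \<le> g (y - fst z) * visit_moment \<mu> a k x" unfolding g_def by (rule le)
          also have "\<dots> \<le> g (y - fst z) * B"
            unfolding B_def using Suc.prems incseqD[OF incseq_visit_moment] by (intro mult_left_mono) auto
          finally have "ennreal (exp a) * visit_moment \<mu> a k (y - fst z) \<le> ennreal (exp a) * (B * g (y - fst z))"
            by (intro mult_left_mono) (auto simp: mult.commute)
          then show ?thesis using True by (simp add: mult.assoc add_increasing)
        next
          case False
          then show ?thesis using Suc.IH[of "y - fst z"] Suc.prems by simp
        qed
      qed
      also have "\<dots> = 1 + ennreal (exp a) * B * D (Suc k) y"
        unfolding D_Suc using emeasure_space_1 by (subst nn_integral_add) (auto simp: nn_integral_cmult)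
      finally show ?case .
    qed simp
    obtain b where b: "B = ennreal b" "b \<ge> 0" using visit_moment_finite[of n x] unfolding B_def[symmetric] by (cases B) auto
    have "B \<le> 1 + ennreal (exp a) * B * D n x" using *[of n x] by (simp add: B_def)
    also have "\<dots> \<le> 1 + ennreal (exp a) * B * ennreal (exp (- a) / 2)"
      by (intro add_left_mono mult_left_mono Dx) auto
    also have "\<dots> = ennreal (1 + exp a * b * (exp (- a) / 2))"
      using b by (simp add: ennreal_mult[symmetric])
    also have "1 + exp a * b * (exp (- a) / 2) = 1 + b / 2" by (simp add: exp_minus field_simps)
    finally have "b \<le> 1 + b / 2" using b by (simp add: ennreal_le_iff del: ennreal_plus)
    then show ?thesis using b unfolding B_def by (simp add: ennreal_leI flip: ennreal_numeral)
  qed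
  then have "full_moment x \<le> 2" unfolding full_moment_def by (intro SUP_least) simp
  then show ?thesis by (intro exI[of _ x]) (auto intro: le_less_trans)
qed

end

lemma ennreal_le_suminf: "f n \<le> (\<Sum>n. f n :: ennreal)"
  using sum_le_suminf[of f "{n}"] by simp

section \<open>Nonnegative steps\<close>

context step_law
begin

lemma AE_path:
  assumes "AE z in \<mu>. P z"
  shows "AE \<omega> in path_space. \<forall>i. P (\<omega> i)"
  unfolding AE_all_countable
  using AE_PiM_component[of UNIV "\<lambda>_. \<mu>", OF _ _ assms] prob_space_axioms by auto

text \<open>The level never rises, so by monotonicity the remaining moment compares with the one at
  x with constant 1. For positive arguments \<open>\<infinity>\<close> is an admissible value
  because moments are at least 1, and almost surely it is never taken along the walk.\<close>

lemma ex_full_moment_finite_nonneg: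
  assumes nonneg: "AE z in \<mu>. 0 \<le> fst z"
    and bdd: "AE \<omega> in path_space. \<exists>b. \<forall>n. b \<le> seq_walk n \<omega> + snd (\<omega> n)"
  shows "\<exists>x. full_moment x < \<infinity>"
proof (rule ex_full_moment_finite[OF _ _ _ bdd])
  let ?\<kappa> = "\<lambda>d::real. if d \<le> 0 then 1 else \<infinity> :: ennreal"
  interpret P: prob_space path_space by (rule prob_space_path)
  show "?\<kappa> \<in> borel_measurable borel" by measurable
  show "visit_moment \<mu> a n y \<le> ?\<kappa> (y - x) * visit_moment \<mu> a n x" for n x y
  proof (cases "y \<le> x")
    case False
    have "visit_moment \<mu> a n x \<noteq> 0" using visit_moment_ge_1[of n x] by auto
    then show ?thesis using False by (simp add: ennreal_top_mult)
  qed (simp add: visit_moment_mono)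
  have "(\<integral>\<^sup>+ \<omega>. (SUP n. ?\<kappa> (- seq_walk n \<omega>)) \<partial>path_space) = (\<integral>\<^sup>+ \<omega>. 1 \<partial>path_space)"
  proof (rule nn_integral_cong_AE)
    show "AE \<omega> in path_space. (SUP n. ?\<kappa> (- seq_walk n \<omega>)) = 1"
      using AE_path[OF nonneg]
    proof eventually_elim
      case (elim \<omega>)
      have "0 \<le> seq_walk n \<omega>" for n unfolding seq_walk_def using elim by (intro sum_nonneg) auto
      then show ?case by simp
    qed
  qed
  then show "(\<integral>\<^sup>+ \<omega>. (SUP n. ?\<kappa> (- seq_walk n \<omega>)) \<partial>path_space) < \<infinity>"
    by (simp add: P.emeasure_space_1)
qed

text \<open>Splitting according to whether the first step is less than \<open>\<epsilon>\<close> bounds the moment at \<open>y\<close> by a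
  multiple of the moment at \<open>y - \<epsilon>\<close>, uniformly in \<open>y \<le> x\<close>.\<close>

lemma full_moment_finite_nonneg:
  assumes nonneg: "AE z in \<mu>. 0 \<le> fst z"
    and x0: "full_moment x0 < \<infinity>"
    and c: "(\<integral>\<^sup>+ z. ennreal (exp (if snd z \<le> x then a else 0)) * indicator {z. fst z = 0} z \<partial>\<mu>) < 1"
  shows "full_moment x < \<infinity>"
proof -
  define w where "w z = ennreal (exp (if snd z \<le> x then a else 0))" for z :: "real \<times> real"
  have [measurable]: "w \<in> borel_measurable \<mu>" unfolding w_def by measurable
  have [measurable]: "(\<lambda>z. indicator {z. fst z < t} z :: ennreal) \<in> borel_measurable \<mu>" for t :: real
    unfolding indicator_def mem_Collect_eq by measurable
  \<comment> \<open>As \<open>i\<close> grows these decrease to the integral over {\<xi> = 0}, which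
    is below 1 by assumption, so a positive threshold for the step already gives a factor below
    1.\<close>
  define C where "C i = (\<integral>\<^sup>+ z. w z * indicator {z. fst z < 1 / Suc i} z \<partial>\<mu>)" for i
  have "(INF i. C i) = (\<integral>\<^sup>+ z. (INF i. w z * indicator {z. fst z < 1 / Suc i} z) \<partial>\<mu>)"
    unfolding C_def
  proof (rule nn_integral_monotone_convergence_INF_AE[symmetric])
    fix i :: nat
    have "1 / real (Suc (Suc i)) \<le> 1 / real (Suc i)" by (simp add: field_simps)
    then have "{z :: real \<times> real. fst z < 1 / Suc (Suc i)} \<subseteq> {z. fst z < 1 / Suc i}" by auto
    then show "AE z in \<mu>. w z * indicator {z. fst z < 1 / Suc (Suc i)} z \<le> w z * indicator {z. fst z < 1 / Suc i} z"
      by (intro AE_I2 mult_left_mono) (auto simp: indicator_def)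
    have "(\<integral>\<^sup>+ z. w z * indicator {z. fst z < 1 / Suc i} z \<partial>\<mu>) \<le> (\<integral>\<^sup>+ z. ennreal (exp a) \<partial>\<mu>)"
      by (intro nn_integral_mono) (auto simp: w_def indicator_def a_pos less_imp_le)
    also have "\<dots> < \<infinity>" using emeasure_space_1 by simp
    finally show "(\<integral>\<^sup>+ z. w z * indicator {z. fst z < 1 / Suc i} z \<partial>\<mu>) < \<infinity>" .
  qed measurable
  also have "\<dots> = (\<integral>\<^sup>+ z. w z * indicator {z. fst z = 0} z \<partial>\<mu>)"
  proof (rule nn_integral_cong_AE)
    show "AE z in \<mu>. (INF i. w z * indicator {z. fst z < 1 / Suc i} z) = w z * indicator {z. fst z = 0} z"
      using nonneg
    proof eventually_elim
      case (elim z)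
      show ?case
      proof (cases "fst z = 0")
        case False
        then obtain i where "1 / Suc i < fst z" using elim nat_approx_posE[of "fst z"] by auto
        then have "(INF i. w z * indicator {z. fst z < 1 / Suc i} z) \<le> 0"
          by (intro INF_lower2[of i]) auto
        then show ?thesis using False by simp
      qed simp
    qed
  qed
  finally have "(INF i. C i) < 1" using c unfolding w_def by simp
  then obtain i where i: "C i < 1" by (auto simp: INF_less_iff)
  define \<epsilon> where "\<epsilon> = 1 / real (Suc i)"
  have \<epsilon>: "\<epsilon> > 0" by (simp add: \<epsilon>_def)
  obtain q where q: "C i = ennreal q" "q \<ge> 0" "q < 1"
    using i by (cases "C i") (auto simp: ennreal_less_one_iff)
  \<comment> \<open>Solves v \<le> q v + exp(a) u for v: steps below \<epsilon> are charged the
    moment v at y, the others the moment u at y - \<epsilon> with the maximal weight.\<close>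
  define r where "r = exp a / (1 - q)"
  have step: "visit_moment \<mu> a n y \<le> ennreal r * visit_moment \<mu> a n (y - \<epsilon>)" if "y \<le> x" for n y
  proof -
    obtain v where v: "visit_moment \<mu> a n y = ennreal v" "v \<ge> 0" using visit_moment_finite[of n y] by (cases "visit_moment \<mu> a n y") auto
    obtain u where u: "visit_moment \<mu> a n (y - \<epsilon>) = ennreal u" "u \<ge> 0" using visit_moment_finite[of n "y - \<epsilon>"] by (cases "visit_moment \<mu> a n (y - \<epsilon>)") auto
    have "visit_moment \<mu> a n y \<le> visit_moment \<mu> a (Suc n) y" by (rule visit_moment_Suc_ge)
    also have "\<dots> \<le> (\<integral>\<^sup>+ z. visit_moment \<mu> a n y * (w z * indicator {z. fst z < \<epsilon>} z) + ennreal (exp a) * visit_moment \<mu> a n (y - \<epsilon>) \<partial>\<mu>)"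
      unfolding visit_moment.simps
    proof (rule nn_integral_mono_AE)
      show "AE z in \<mu>. ennreal (exp (if snd z \<le> y then a else 0)) * visit_moment \<mu> a n (y - fst z)
          \<le> visit_moment \<mu> a n y * (w z * indicator {z. fst z < \<epsilon>} z) + ennreal (exp a) * visit_moment \<mu> a n (y - \<epsilon>)"
        using nonneg
      proof eventually_elim
        case (elim z)
        show ?case
        proof (cases "fst z < \<epsilon>")
          case True
          have "ennreal (exp (if snd z \<le> y then a else 0)) * visit_moment \<mu> a n (y - fst z) \<le> w z * visit_moment \<mu> a n y"
            unfolding w_def using elim that by (intro mult_mono weight_mono visit_moment_mono) auto
          then show ?thesis using True by (simp add: mult.commute add_increasing2)
        next
          case False
          have "ennreal (exp (if snd z \<le> y then a else 0)) * visit_moment \<mu> a n (y - fst z) \<le> ennreal (exp a) * visit_moment \<mu> a n (y - \<epsilon>)"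
            using False by (intro mult_mono weight_le visit_moment_mono) auto
          then show ?thesis by (simp add: add_increasing)
        qed
      qed
    qed
    also have "\<dots> = visit_moment \<mu> a n y * C i + ennreal (exp a) * visit_moment \<mu> a n (y - \<epsilon>)"
      unfolding C_def \<epsilon>_def using emeasure_space_1 by (subst nn_integral_add) (auto simp: nn_integral_cmult)
    finally have "v \<le> v * q + exp a * u"
      unfolding v u q using v u q by (simp add: ennreal_mult[symmetric] ennreal_plus[symmetric] ennreal_le_iff del: ennreal_plus)
    then have "v \<le> r * u" using q by (simp add: r_def field_simps)
    then show ?thesis unfolding v u using u q by (simp add: ennreal_mult'[symmetric] r_def ennreal_leI)
  qed
  have iter: "visit_moment \<mu> a n x \<le> ennreal r ^ m * visit_moment \<mu> a n (x - real m * \<epsilon>)" for n m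
  proof (induction m)
    case (Suc m)
    have "visit_moment \<mu> a n x \<le> ennreal r ^ m * visit_moment \<mu> a n (x - real m * \<epsilon>)" by (rule Suc)
    also have "\<dots> \<le> ennreal r ^ m * (ennreal r * visit_moment \<mu> a n (x - real m * \<epsilon> - \<epsilon>))"
      using \<epsilon> by (intro mult_left_mono step) auto
    finally show ?case by (simp add: algebra_simps)
  qed simp
  obtain m :: nat where m: "x - x0 < real m * \<epsilon>" using \<epsilon> reals_Archimedean3 by blast
  have "full_moment x \<le> ennreal r ^ m * full_moment x0"
    unfolding full_moment_def[of x]
  proof (rule SUP_least)
    fix n
    have "visit_moment \<mu> a n (x - real m * \<epsilon>) \<le> full_moment x0"
      using m visit_moment_mono[of "x - real m * \<epsilon>" x0 n] visit_moment_le_full_moment[of n x0] by auto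
    then show "visit_moment \<mu> a n x \<le> ennreal r ^ m * full_moment x0"
      by (intro order_trans[OF iter mult_left_mono]) auto
  qed
  also have "\<dots> < \<infinity>" using x0 q by (simp add: ennreal_mult_less_top ennreal_power r_def)
  finally show ?thesis .
qed

text \<open>If the integral were at least 1, the zero steps alone would reproduce the moment at x in
  the one-step equation, and the nonzero steps would add at least their positive probability, which
  a finite moment cannot absorb.\<close>

lemma zero_step_less_1:
  assumes nonneg: "AE z in \<mu>. 0 \<le> fst z" and nontriv: "emeasure \<mu> {z. fst z = 0} < 1"
    and fin: "full_moment x < \<infinity>"
  shows "(\<integral>\<^sup>+ z. ennreal (exp (if snd z \<le> x then a else 0)) * indicator {z. fst z = 0} z \<partial>\<mu>) < 1"
proof (rule ccontr)
  let ?c = "\<integral>\<^sup>+ z. ennreal (exp (if snd z \<le> x then a else 0)) * indicator {z. fst z = 0} z \<partial>\<mu>"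
  assume "\<not> ?c < 1"
  then have c: "1 \<le> ?c" by simp
  have [measurable]: "(\<lambda>z. indicator {z. fst z = 0} z :: ennreal) \<in> borel_measurable \<mu>"
    "(\<lambda>z. indicator {z. fst z \<noteq> 0} z :: ennreal) \<in> borel_measurable \<mu>"
    unfolding indicator_def mem_Collect_eq by measurable
  have "full_moment x + emeasure \<mu> {z. fst z \<noteq> 0} \<le> full_moment x * ?c + (\<integral>\<^sup>+ z. indicator {z. fst z \<noteq> 0} z \<partial>\<mu>)"
  proof (rule add_mono)
    show "full_moment x \<le> full_moment x * ?c" using mult_left_mono[OF c, of "full_moment x"] by simp
    show "emeasure \<mu> {z. fst z \<noteq> 0} \<le> (\<integral>\<^sup>+ z. indicator {z. fst z \<noteq> 0} z \<partial>\<mu>)"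
      by (subst nn_integral_indicator) (auto intro!: events_Collect)
  qed
  also have "\<dots> = (\<integral>\<^sup>+ z. full_moment x * (ennreal (exp (if snd z \<le> x then a else 0)) * indicator {z. fst z = 0} z) + indicator {z. fst z \<noteq> 0} z \<partial>\<mu>)"
    by (subst nn_integral_add) (auto simp: nn_integral_cmult)
  also have "\<dots> \<le> (\<integral>\<^sup>+ z. ennreal (exp (if snd z \<le> x then a else 0)) * full_moment (x - fst z) \<partial>\<mu>)"
  proof (intro nn_integral_mono)
    fix z :: "real \<times> real"
    have "1 * 1 \<le> ennreal (exp (if snd z \<le> x then a else 0)) * full_moment (x - fst z)"
      by (intro mult_mono weight_ge_1 full_moment_ge_1) auto
    then show "full_moment x * (ennreal (exp (if snd z \<le> x then a else 0)) * indicator {z. fst z = 0} z) + indicator {z. fst z \<noteq> 0} z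
        \<le> ennreal (exp (if snd z \<le> x then a else 0)) * full_moment (x - fst z)"
      by (cases "fst z = 0") (auto simp: mult.commute)
  qed
  also have "\<dots> = full_moment x + 0" by (simp add: full_moment_eq[symmetric])
  finally have "emeasure \<mu> {z. fst z \<noteq> 0} = 0"
    using fin by (subst (asm) ennreal_add_left_cancel_le) auto
  then have "AE z in \<mu>. z \<in> {z. fst z = 0}"
    by (intro AE_I[where N = "{z. fst z \<noteq> 0}"]) (auto intro!: events_Collect)
  then have "emeasure \<mu> {z. fst z = 0} = 1" by (subst (asm) prob_eq_1[symmetric]) (auto intro!: events_Collect simp: emeasure_eq_measure)
  then show False using nontriv by simp
qed

section \<open>Steps with an exponential drift\<close>

lemma nn_integral_exp_seq_walk:
  "(\<integral>\<^sup>+ \<omega>. ennreal (exp (- \<theta> * seq_walk n \<omega>)) \<partial>path_space) = (\<integral>\<^sup>+ z. ennreal (exp (- \<theta> * fst z)) \<partial>\<mu>) ^ n"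
proof (induction n)
  case 0
  interpret P: prob_space path_space by (rule prob_space_path)
  show ?case by (simp add: P.emeasure_space_1)
next
  case (Suc n)
  have "(\<integral>\<^sup>+ \<omega>. ennreal (exp (- \<theta> * seq_walk (Suc n) \<omega>)) \<partial>path_space)
      = (\<integral>\<^sup>+ z. (\<integral>\<^sup>+ \<omega>. ennreal (exp (- \<theta> * seq_walk (Suc n) (case_nat z \<omega>))) \<partial>path_space) \<partial>\<mu>)"
    by (rule nn_integral_path) measurable
  also have "\<dots> = (\<integral>\<^sup>+ z. (\<integral>\<^sup>+ \<omega>. ennreal (exp (- \<theta> * fst z)) * ennreal (exp (- \<theta> * seq_walk n \<omega>)) \<partial>path_space) \<partial>\<mu>)"
    by (intro nn_integral_cong)
       (simp add: seq_walk_Suc ennreal_mult[symmetric] exp_add[symmetric] algebra_simps)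
  also have "\<dots> = (\<integral>\<^sup>+ z. ennreal (exp (- \<theta> * fst z)) * (\<integral>\<^sup>+ z. ennreal (exp (- \<theta> * fst z)) \<partial>\<mu>) ^ n \<partial>\<mu>)"
    by (intro nn_integral_cong, subst nn_integral_cmult) (measurable, simp only: Suc)
  also have "\<dots> = (\<integral>\<^sup>+ z. ennreal (exp (- \<theta> * fst z)) \<partial>\<mu>) ^ Suc n"
    by (subst nn_integral_multc) (simp_all add: mult.commute)
  finally show ?case .
qed

end

text \<open>Stands for a \<le> R with a witness: the law of \<xi>, scaled by e^a and tilted by
  exp(-\<theta> s), is substochastic.\<close>

locale exp_drift = step_law +
  fixes \<theta> :: real
  assumes \<theta>_nonneg: "\<theta> \<ge> 0"
    and exp_drift: "(\<integral>\<^sup>+ z. ennreal (exp (- \<theta> * fst z)) \<partial>\<mu>) \<le> ennreal (exp (- a))"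
begin

lemma \<theta>_pos: "\<theta> > 0"
proof (rule ccontr)
  assume "\<not> \<theta> > 0"
  then have "(1::ennreal) \<le> ennreal (exp (- a))" using exp_drift \<theta>_nonneg emeasure_space_1 by simp
  then show False using a_pos by (simp add: ennreal_1[symmetric] ennreal_le_iff del: ennreal_1)
qed

text \<open>The transform of S_n is at most exp(-a n), so the series is geometric even when a = R.
  The sum serves both to bound the walk from below and to dominate passage moments along the
  path.\<close>

lemma nn_integral_sum_exp: "(\<integral>\<^sup>+ \<omega>. (\<Sum>n. ennreal (exp (- \<theta> * seq_walk n \<omega>))) \<partial>path_space) < \<infinity>"
proof -
  have "(\<integral>\<^sup>+ \<omega>. (\<Sum>n. ennreal (exp (- \<theta> * seq_walk n \<omega>))) \<partial>path_space)
      = (\<Sum>n. (\<integral>\<^sup>+ z. ennreal (exp (- \<theta> * fst z)) \<partial>\<mu>) ^ n)"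
    by (subst nn_integral_suminf) (simp_all only: nn_integral_exp_seq_walk, measurable)
  also have "\<dots> \<le> (\<Sum>n. ennreal (exp (- a) ^ n))"
  proof (intro suminf_le)
    show "(\<integral>\<^sup>+ z. ennreal (exp (- \<theta> * fst z)) \<partial>\<mu>) ^ n \<le> ennreal (exp (- a) ^ n)" for n
      by (simp only: ennreal_power[symmetric] exp_ge_zero) (rule power_mono[OF exp_drift], simp)
  qed auto
  also have "\<dots> < \<infinity>"
    using a_pos by (subst suminf_ennreal2) (auto intro!: summable_geometric)
  finally show ?thesis .
qed

text \<open>Every term of an almost surely finite sum bounds S_n from below. For the unperturbed
  walk this stands in for positive divergence, which is assumed of T only.\<close>

lemma seq_walk_bounded_below: "AE \<omega> in path_space. \<exists>b. \<forall>n. b \<le> seq_walk n \<omega>"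
proof -
  have "AE \<omega> in path_space. (\<Sum>n. ennreal (exp (- \<theta> * seq_walk n \<omega>))) \<noteq> \<infinity>"
    using nn_integral_sum_exp by (intro nn_integral_PInf_AE) auto
  then show ?thesis
  proof eventually_elim
    case (elim \<omega>)
    define \<Sigma> where "\<Sigma> = (\<Sum>n. ennreal (exp (- \<theta> * seq_walk n \<omega>)))"
    have "\<Sigma> \<noteq> \<infinity>" using elim unfolding \<Sigma>_def .
    then obtain s where s: "\<Sigma> = ennreal s" "s \<ge> 0" by (cases \<Sigma>) auto
    have "- s / \<theta> \<le> seq_walk n \<omega>" for n
    proof -
      have "ennreal (exp (- \<theta> * seq_walk n \<omega>)) \<le> \<Sigma>"
        unfolding \<Sigma>_def by (rule ennreal_le_suminf)
      then have "exp (- \<theta> * seq_walk n \<omega>) \<le> s" unfolding s(1) using s(2) by (simp add: ennreal_le_iff)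
      then have "- \<theta> * seq_walk n \<omega> \<le> s"
        using exp_ge_add_one_self[of "- \<theta> * seq_walk n \<omega>"] by linarith
      then have "- s \<le> seq_walk n \<omega> * \<theta>" by (simp add: mult.commute)
      then show ?thesis by (simp only: pos_divide_le_eq[OF \<theta>_pos])
    qed
    then show ?case by blast
  qed
qed

text \<open>A walk started at \<open>y > x\<close> first has to pass below \<open>x\<close>, so the passage moment serves as \<open>\<kappa>\<close>; its
  supremum along the path is dominated by the integrable \<open>1 + Z (\<Sum>n. exp (- \<theta> S\<^sub>n))\<close>.\<close>

lemma ex_full_moment_finite_exp_drift:
  assumes bdd: "AE \<omega> in path_space. \<exists>b. \<forall>n. b \<le> seq_walk n \<omega> + snd (\<omega> n)"
  shows "\<exists>x. full_moment x < \<infinity>"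
proof -
  interpret P: prob_space path_space by (rule prob_space_path)
  define Q where "Q = scale_measure (ennreal (exp a)) (distr \<mu> borel fst)"
  have fst_meas [measurable]: "fst \<in> borel_measurable \<mu>" by measurable
  have sets_Q: "sets Q = sets borel" by (simp add: Q_def)
  have int_Q: "(\<integral>\<^sup>+ s. f s \<partial>Q) = ennreal (exp a) * (\<integral>\<^sup>+ z. f (fst z) \<partial>\<mu>)" if "f \<in> borel_measurable borel" for f
    unfolding Q_def using that by (subst nn_integral_scale_measure) (auto simp: nn_integral_distr)
  have em_Q: "emeasure Q UNIV = ennreal (exp a)"
    unfolding Q_def using emeasure_space_1 by (simp add: emeasure_distr)
  interpret Q: heavy_step_measure Q
  proof (intro heavy_step_measure.intro step_measure.intro finite_measureI
      step_measure_axioms.intro heavy_step_measure_axioms.intro sets_Q)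
    have "space Q = UNIV" using sets_eq_imp_space_eq[OF sets_Q] by simp
    then show "emeasure Q (space Q) \<noteq> \<infinity>" by (simp add: em_Q)
    show "1 < emeasure Q UNIV" unfolding em_Q using a_pos by (simp add: ennreal_1[symmetric] ennreal_less_iff del: ennreal_1)
  qed
  have "(\<integral>\<^sup>+ s. ennreal (exp (- \<theta> * s)) \<partial>Q) \<le> ennreal (exp a) * ennreal (exp (- a))"
    by (subst int_Q) (measurable, rule mult_left_mono[OF exp_drift], simp)
  also have "\<dots> = 1" by (simp add: ennreal_mult[symmetric] exp_add[symmetric])
  finally obtain Z where Z: "Z \<ge> 0" "\<And>n y. passage_moment Q n y \<le> 1 + ennreal (Z * exp (\<theta> * y))"
    using Q.passage_moment_exp_bound[OF \<theta>_pos] by blast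
  \<comment> \<open>Until the level falls below \<open>x\<close> each step costs at most exp(a),
    which is what \<open>Q\<close> charges; from then on monotonicity suffices.\<close>
  have visit_moment_passage_moment: "visit_moment \<mu> a n y \<le> passage_moment Q n (y - x) * visit_moment \<mu> a n x" for n x y
  proof (induction n arbitrary: y)
    case (Suc n)
    show ?case
    proof (cases "y - x < 0")
      case True
      then show ?thesis using visit_moment_mono[of y x "Suc n"] by simp
    next
      case False
      have "visit_moment \<mu> a (Suc n) y = (\<integral>\<^sup>+ z. ennreal (exp (if snd z \<le> y then a else 0)) * visit_moment \<mu> a n (y - fst z) \<partial>\<mu>)"
        by simp
      also have "\<dots> \<le> (\<integral>\<^sup>+ z. ennreal (exp a) * (passage_moment Q n (y - x - fst z) * visit_moment \<mu> a (Suc n) x) \<partial>\<mu>)"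
      proof (intro nn_integral_mono mult_mono weight_le)
        fix z :: "real \<times> real"
        have "visit_moment \<mu> a n (y - fst z) \<le> passage_moment Q n (y - fst z - x) * visit_moment \<mu> a n x" by (rule Suc)
        also have "\<dots> \<le> passage_moment Q n (y - fst z - x) * visit_moment \<mu> a (Suc n) x" by (intro mult_left_mono visit_moment_Suc_ge) auto
        finally show "visit_moment \<mu> a n (y - fst z) \<le> passage_moment Q n (y - x - fst z) * visit_moment \<mu> a (Suc n) x"
          by (simp only: diff_diff_eq add.commute)
      qed auto
      also have "\<dots> = ennreal (exp a) * (\<integral>\<^sup>+ z. passage_moment Q n (y - x - fst z) \<partial>\<mu>) * visit_moment \<mu> a (Suc n) x"
        by (simp add: nn_integral_cmult nn_integral_multc mult.assoc del: visit_moment.simps)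
      also have "\<dots> = passage_moment Q (Suc n) (y - x) * visit_moment \<mu> a (Suc n) x"
        using False by (simp add: int_Q del: visit_moment.simps)
      finally show ?thesis .
    qed
  qed simp
  define \<kappa> where "\<kappa> y = 1 + ennreal (Z * exp (\<theta> * y))" for y
  show ?thesis
  proof (rule ex_full_moment_finite[OF _ _ _ bdd])
    show "\<kappa> \<in> borel_measurable borel" unfolding \<kappa>_def by measurable
    show "visit_moment \<mu> a n y \<le> \<kappa> (y - x) * visit_moment \<mu> a n x" for n x y
      unfolding \<kappa>_def by (rule order_trans[OF visit_moment_passage_moment mult_right_mono[OF Z(2)]]) auto
    have "(\<integral>\<^sup>+ \<omega>. (SUP n. \<kappa> (- seq_walk n \<omega>)) \<partial>path_space)
        \<le> (\<integral>\<^sup>+ \<omega>. 1 + ennreal Z * (\<Sum>n. ennreal (exp (- \<theta> * seq_walk n \<omega>))) \<partial>path_space)"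
    proof (intro nn_integral_mono SUP_least)
      fix \<omega> and n :: nat
      have "ennreal (Z * exp (\<theta> * - seq_walk n \<omega>)) = ennreal Z * ennreal (exp (- \<theta> * seq_walk n \<omega>))"
        using Z(1) by (simp add: ennreal_mult)
      also have "\<dots> \<le> ennreal Z * (\<Sum>n. ennreal (exp (- \<theta> * seq_walk n \<omega>)))"
        by (rule mult_left_mono[OF ennreal_le_suminf]) simp
      finally show "\<kappa> (- seq_walk n \<omega>) \<le> 1 + ennreal Z * (\<Sum>n. ennreal (exp (- \<theta> * seq_walk n \<omega>)))"
        unfolding \<kappa>_def by (rule add_left_mono)
    qed
    also have "\<dots> = 1 + ennreal Z * (\<integral>\<^sup>+ \<omega>. (\<Sum>n. ennreal (exp (- \<theta> * seq_walk n \<omega>))) \<partial>path_space)"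
      by (subst nn_integral_add, measurable, subst nn_integral_cmult, measurable)
         (simp only: nn_integral_const P.emeasure_space_1 mult_1)
    also have "\<dots> < \<infinity>"
    proof -
      define J where "J = (\<integral>\<^sup>+ \<omega>. (\<Sum>n. ennreal (exp (- \<theta> * seq_walk n \<omega>))) \<partial>path_space)"
      have "J < \<infinity>" unfolding J_def by (rule nn_integral_sum_exp)
      then show ?thesis unfolding J_def[symmetric] by (simp add: ennreal_mult_less_top)
    qed
    finally show "(\<integral>\<^sup>+ \<omega>. (SUP n. \<kappa> (- seq_walk n \<omega>)) \<partial>path_space) < \<infinity>" .
  qed
qed

end

section \<open>Finiteness implies an exponential drift\<close>

context step_law
begin

text \<open>Restricting to bounded \<open>\<eta>\<close> makes every step below the current level count, so the number of visits
  dominates a passage time; the restriction is removed by compactness.\<close>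

lemma ex_exp_drift:
  assumes neg: "emeasure \<mu> {z. fst z < 0} > 0" and fin: "\<And>y. full_moment y < \<infinity>"
  shows "\<exists>\<theta>\<ge>0. (\<integral>\<^sup>+ z. ennreal (exp (- \<theta> * fst z)) \<partial>\<mu>) \<le> ennreal (exp (- a))"
proof -
  \<comment> \<open>With levels shifted by \<open>n\<close>, the bound on \<open>snd z\<close> turns
    every step taken from a level y \<ge> 0 into a visit. The bound on \<open>fst z\<close> supplies
    the lower bound on steps required by \<open>ex_laplace_le\<close>.\<close>
  define A :: "nat \<Rightarrow> (real \<times> real) set" where "A n = {z. snd z \<le> real n \<and> - real n \<le> fst z}" for n
  have A_sets [measurable]: "A n \<in> sets \<mu>" for n unfolding A_def by (rule events_Collect) measurable
  have fst_meas [measurable]: "fst \<in> borel_measurable \<mu>" by measurable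
  have "\<exists>t\<ge>0. (\<integral>\<^sup>+ z. ennreal (exp (- t * fst z)) * indicator (A b) z \<partial>\<mu>) \<le> ennreal (exp (- a) + 1 / Suc b)" for b
  proof -
    define Q where "Q = distr (density \<mu> (\<lambda>z. ennreal (exp a) * indicator (A b) z)) borel fst"
    have sets_Q: "sets Q = sets borel" and space_Q: "space Q = UNIV" by (simp_all add: Q_def)
    have int_Q: "(\<integral>\<^sup>+ s. f s \<partial>Q) = ennreal (exp a) * (\<integral>\<^sup>+ z. f (fst z) * indicator (A b) z \<partial>\<mu>)"
      if [measurable]: "f \<in> borel_measurable borel" for f
    proof -
      have "(\<integral>\<^sup>+ s. f s \<partial>Q) = (\<integral>\<^sup>+ z. ennreal (exp a) * indicator (A b) z * f (fst z) \<partial>\<mu>)"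
        unfolding Q_def by (subst nn_integral_distr) (auto simp: nn_integral_density)
      also have "\<dots> = (\<integral>\<^sup>+ z. ennreal (exp a) * (f (fst z) * indicator (A b) z) \<partial>\<mu>)"
        by (intro nn_integral_cong) (simp add: ac_simps)
      also have "\<dots> = ennreal (exp a) * (\<integral>\<^sup>+ z. f (fst z) * indicator (A b) z \<partial>\<mu>)"
        by (rule nn_integral_cmult) measurable
      finally show ?thesis .
    qed
    have em_Q: "emeasure Q UNIV = ennreal (exp a) * emeasure \<mu> (A b)"
      using int_Q[of "\<lambda>_. 1"] by (simp add: space_Q)
    have Q_step: "step_measure Q"
    proof (intro step_measure.intro finite_measureI step_measure_axioms.intro sets_Q)
      show "emeasure Q (space Q) \<noteq> \<infinity>"
        by (simp add: space_Q em_Q ennreal_mult_eq_top_iff emeasure_eq_measure)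
    qed
    have goal_Q: "(\<integral>\<^sup>+ z. ennreal (exp (- t * fst z)) * indicator (A b) z \<partial>\<mu>) \<le> ennreal (exp (- a) * c)"
      if "(\<integral>\<^sup>+ s. ennreal (exp (- t * s)) \<partial>Q) \<le> ennreal c" for t c
    proof -
      have "ennreal (exp a) * (\<integral>\<^sup>+ z. ennreal (exp (- t * fst z)) * indicator (A b) z \<partial>\<mu>) \<le> ennreal c"
        using that by (subst (asm) int_Q) measurable
      then have "ennreal (exp (- a)) * (ennreal (exp a) * (\<integral>\<^sup>+ z. ennreal (exp (- t * fst z)) * indicator (A b) z \<partial>\<mu>))
          \<le> ennreal (exp (- a)) * ennreal c"
        by (rule mult_left_mono) simp
      moreover have "ennreal (exp (- a)) * ennreal (exp a) = 1"
        by (simp add: ennreal_mult[symmetric] exp_add[symmetric])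
      ultimately show ?thesis by (simp only: mult.assoc[symmetric] mult_1 ennreal_mult' exp_ge_zero)
    qed
    show ?thesis
    proof (cases "emeasure Q UNIV > 1")
      case False
      \<comment> \<open>When the truncated mass is at most 1, the exponent 0 already works.\<close>
      then have "(\<integral>\<^sup>+ s. ennreal (exp (- 0 * s)) \<partial>Q) \<le> ennreal 1" by (simp add: space_Q not_less)
      from goal_Q[OF this]
      have "(\<integral>\<^sup>+ z. ennreal (exp (- 0 * fst z)) * indicator (A b) z \<partial>\<mu>) \<le> ennreal (exp (- a) + 1 / Suc b)"
        by (rule order_trans[OF _ ennreal_leI]) simp
      then show ?thesis by (intro exI[of _ 0]) (simp only: order_refl simp_thms)
    next
      case True
      then interpret Q: heavy_step_measure Q
        by (intro heavy_step_measure.intro Q_step heavy_step_measure_axioms.intro)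
      \<comment> \<open>Discarding the steps outside \<open>A b\<close> and all visits after the
        passage only lowers the moment.\<close>
      have "passage_moment Q n y \<le> visit_moment \<mu> a n (y + real b)" for n y
      proof (induction n arbitrary: y)
        case (Suc n)
        show ?case
        proof (cases "y < 0")
          case True
          then show ?thesis using visit_moment_ge_1[of "Suc n" "y + real b"] by (simp del: visit_moment.simps)
        next
          case False
          have "passage_moment Q (Suc n) y = (\<integral>\<^sup>+ z. ennreal (exp a) * (passage_moment Q n (y - fst z) * indicator (A b) z) \<partial>\<mu>)"
            using False by (simp add: int_Q nn_integral_cmult)
          also have "\<dots> \<le> (\<integral>\<^sup>+ z. ennreal (exp (if snd z \<le> y + real b then a else 0)) * visit_moment \<mu> a n (y + real b - fst z) \<partial>\<mu>)"
          proof (intro nn_integral_mono)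
            fix z :: "real \<times> real"
            show "ennreal (exp a) * (passage_moment Q n (y - fst z) * indicator (A b) z)
                \<le> ennreal (exp (if snd z \<le> y + real b then a else 0)) * visit_moment \<mu> a n (y + real b - fst z)"
            proof (cases "z \<in> A b")
              case True
              then have "snd z \<le> y + real b" using False by (auto simp: A_def)
              moreover have "passage_moment Q n (y - fst z) \<le> visit_moment \<mu> a n (y + real b - fst z)"
                using Suc[of "y - fst z"] by (simp add: algebra_simps)
              ultimately show ?thesis using True by (auto intro: mult_left_mono)
            qed simp
          qed
          finally show ?thesis by simp
        qed
      qed simp
      then have "(SUP n. passage_moment Q n y) \<le> full_moment (y + real b)" for y
        by (intro SUP_least order_trans[OF _ visit_moment_le_full_moment])
      then have fin_Q: "(SUP n. passage_moment Q n y) < \<infinity>" for y using fin le_less_trans by blast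
      have AE_Q: "AE s in Q. - real b \<le> s"
        unfolding Q_def by (subst AE_distr_iff) (auto simp: AE_density A_def split: split_indicator)
      \<comment> \<open>The tolerance is chosen so that division by exp(a) leaves 1/(b+1), as
        \<open>ex_exp_integral_le\<close> expects.\<close>
      obtain t where t: "t \<ge> 0" "(\<integral>\<^sup>+ s. ennreal (exp (- t * s)) \<partial>Q) \<le> ennreal (1 + exp a / Suc b)"
        using Q.ex_laplace_le[of "real b" "exp a / Suc b"] AE_Q fin_Q by auto
      have "exp (- a) * (1 + exp a / Suc b) = exp (- a) + 1 / Suc b"
        by (simp add: distrib_left exp_minus)
      then show ?thesis using goal_Q[OF t(2)] t(1) by (intro exI[of _ t]) (simp only: simp_thms)
    qed
  qed
  then obtain t where t: "\<And>b. t b \<ge> 0"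
    "\<And>b. (\<integral>\<^sup>+ z. ennreal (exp (- t b * fst z)) * indicator (A b) z \<partial>\<mu>) \<le> ennreal (exp (- a) + 1 / Suc b)"
    by metis
  show ?thesis
  proof (rule ex_exp_integral_le[OF fst_meas A_sets _ _ _ t(1) _ t(2)])
    show "incseq A" by (rule incseq_SucI) (auto simp: A_def)
    show "(\<Union>n. A n) = space \<mu>"
    proof -
      have "\<exists>n. z \<in> A n" for z
      proof -
        obtain n where "max (snd z) (- fst z) \<le> real n" using real_arch_simple by blast
        then show ?thesis by (intro exI[of _ n]) (auto simp: A_def)
      qed
      then show ?thesis by auto
    qed
    show "emeasure \<mu> {\<omega> \<in> space \<mu>. fst \<omega> < 0} > 0" using neg by simp
  qed simp
qed

end

section \<open>Transfer to the perturbed random walk\<close>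

lemma num_elems_Suc_image: "num_elems (Suc ` A) = num_elems A"
  by (simp add: num_elems_def card_image finite_image_iff)

text \<open>The counts up to \<open>n\<close> increase to the cardinality; on an infinite set they
  are unbounded, so the supremum agrees with the convention that the exponential of an infinite
  count is \<infinity>.\<close>

lemma exp_num_elems:
  fixes a :: real
  assumes "a > 0"
  shows "(case num_elems {k. P k} of enat n \<Rightarrow> ennreal (exp (a * real n)) | \<infinity> \<Rightarrow> \<infinity>)
    = (SUP n. ennreal (exp (a * real (\<Sum>k<n. if P k then 1 else 0))))"
proof -
  have card_eq: "(\<Sum>k<n. if P k then 1 else 0) = card {k. k < n \<and> P k}" for n :: nat
    by (simp add: sum.If_cases lessThan_def Collect_conj_eq)
  show ?thesis
  proof (cases "finite {k. P k}")
    case True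
    then obtain m where m: "{k. P k} \<subseteq> {..<m}" by (auto simp: finite_nat_iff_bounded)
    have "(SUP n. ennreal (exp (a * real (card {k. k < n \<and> P k})))) = ennreal (exp (a * real (card {k. P k})))"
    proof (rule antisym)
      show "(SUP n. ennreal (exp (a * real (card {k. k < n \<and> P k})))) \<le> ennreal (exp (a * real (card {k. P k})))"
        using True assms by (intro SUP_least ennreal_leI) (auto intro!: card_mono)
      have "{k. k < m \<and> P k} = {k. P k}" using m by auto
      then show "ennreal (exp (a * real (card {k. P k}))) \<le> (SUP n. ennreal (exp (a * real (card {k. k < n \<and> P k}))))"
        by (intro SUP_upper2[of m]) auto
    qed
    then show ?thesis using True by (simp only: card_eq) (simp add: num_elems_def)
  next
    case False
    have "(SUP n. ennreal (exp (a * real (card {k. k < n \<and> P k})))) = top"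
    proof (rule ennreal_SUP_eq_top)
      fix N :: nat
      obtain K :: nat where K: "real N < real K * a" using assms reals_Archimedean3 by blast
      obtain B where B: "finite B" "card B = K" "B \<subseteq> {k. P k}"
        using infinite_arbitrarily_large[OF False] by blast
      then obtain m where "B \<subseteq> {..<m}" by (auto simp: finite_nat_iff_bounded)
      then have "K \<le> card {k. k < m \<and> P k}" using B by (auto intro!: card_mono)
      then have "real K * a \<le> a * real (card {k. k < m \<and> P k})" using assms by (simp add: mult.commute)
      then have "real N \<le> exp (a * real (card {k. k < m \<and> P k}))"
        using K exp_ge_add_one_self[of "a * real (card {k. k < m \<and> P k})"] by linarith
      then show "\<exists>m\<in>UNIV. of_nat N \<le> ennreal (exp (a * real (card {k. k < m \<and> P k})))"
        by (intro bexI[of _ m]) (simp_all add: ennreal_of_nat_eq_real_of_nat ennreal_leI)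
    qed
    then show ?thesis using False by (simp only: card_eq) (simp add: num_elems_def)
  qed
qed

lemma neg_log_ge_iff:
  assumes "p \<le> 1"
  shows "ereal a \<le> neg_log p \<longleftrightarrow> p \<le> ennreal (exp (- a))"
proof (cases p)
  case (real r)
  show ?thesis
  proof (cases "r = 0")
    case False
    then have r: "r > 0" using real by simp
    have "a \<le> - ln r \<longleftrightarrow> r \<le> exp (- a)" using r by (metis exp_le_cancel_iff exp_ln le_minus_iff)
    then show ?thesis using real r by (simp add: neg_log_def ennreal_le_iff)
  qed (use real in \<open>simp add: neg_log_def\<close>)
qed (use assms in \<open>simp add: top_unique\<close>)

text \<open>The third hypothesis keeps the supremum out of the image. For empty \<open>A\<close> the
  supremum is -\<infinity> and both sides are empty.\<close>

lemma ereal_image_eq_greaterThanLessThan: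
  fixes A :: "real set"
  assumes "\<And>b. b \<in> A \<Longrightarrow> 0 < b" "\<And>b c. \<lbrakk>b \<in> A; 0 < c; c < b\<rbrakk> \<Longrightarrow> c \<in> A"
    and "\<And>b. b \<in> A \<Longrightarrow> \<exists>c\<in>A. b < c"
  shows "ereal ` A = {0<..<SUP a\<in>A. ereal a}"
proof (intro equalityI subsetI)
  fix y assume "y \<in> ereal ` A"
  then obtain b where b: "b \<in> A" "y = ereal b" by blast
  obtain c where "c \<in> A" "b < c" using assms(3) b by blast
  then have "ereal b < (SUP a\<in>A. ereal a)" by (intro less_SUP_iff[THEN iffD2]) auto
  then show "y \<in> {0<..<SUP a\<in>A. ereal a}" using b assms(1) by (simp add: zero_ereal_def)
next
  fix y assume y: "y \<in> {0<..<SUP a\<in>A. ereal a}"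
  then obtain b where b: "b \<in> A" "y < ereal b" by (auto simp: less_SUP_iff)
  then obtain r where r: "y = ereal r" using y by (cases y) auto
  then have "r \<in> A" using assms(2)[OF b(1), of r] b y by (simp add: zero_ereal_def)
  then show "y \<in> ereal ` A" using r by blast
qed

text \<open>Has to cover \<eta> = 0 as well, where nondegeneracy of \<eta> fails; the unperturbed
  walk then becomes an instance. Fixing \<open>a\<close> lets \<open>step_law\<close> be a
  sublocale.\<close>

locale iid_pairs = prob_space M for M :: "'a measure" +
  fixes \<xi> \<eta> :: "nat \<Rightarrow> 'a \<Rightarrow> real" and a :: real
  assumes indep: "indep_vars (\<lambda>_. borel) (\<lambda>n \<omega>. (\<xi> n \<omega>, \<eta> n \<omega>)) UNIV"
    and ident: "\<And>n. distr M borel (\<lambda>\<omega>. (\<xi> n \<omega>, \<eta> n \<omega>)) = distr M borel (\<lambda>\<omega>. (\<xi> 0 \<omega>, \<eta> 0 \<omega>))"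
    and a_gt_0: "a > 0"
begin

definition law :: "(real \<times> real) measure" where
  "law = distr M (borel \<Otimes>\<^sub>M borel) (\<lambda>\<omega>. (\<xi> 0 \<omega>, \<eta> 0 \<omega>))"

lemma measurable_pair: "(\<lambda>\<omega>. (\<xi> n \<omega>, \<eta> n \<omega>)) \<in> measurable M (borel \<Otimes>\<^sub>M borel)"
  using indep unfolding indep_vars_def borel_prod by blast

lemma measurable_\<xi> [measurable]: "\<xi> n \<in> borel_measurable M"
  and measurable_\<eta> [measurable]: "\<eta> n \<in> borel_measurable M"
  using measurable_compose[OF measurable_pair[of n] measurable_fst] measurable_compose[OF measurable_pair[of n] measurable_snd]
  by (simp_all only: fst_conv snd_conv)

sublocale law: step_law law a
proof (intro step_law.intro step_law_axioms.intro)
  show "prob_space law" unfolding law_def by (rule prob_space_distr[OF measurable_pair])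
qed (simp_all add: law_def a_gt_0)

text \<open>Drops the generic pair with index 0, so that the path consists of the pairs that enter
  the walks.\<close>

abbreviation future :: "'a \<Rightarrow> nat \<Rightarrow> real \<times> real" where
  "future \<omega> i \<equiv> (\<xi> (Suc i) \<omega>, \<eta> (Suc i) \<omega>)"

lemma measurable_future: "future \<in> measurable M law.path_space"
proof (rule measurable_PiM_single')
  show "(\<lambda>\<omega>. future \<omega> i) \<in> measurable M law" for i
    using measurable_pair[of "Suc i"] measurable_cong_sets[OF refl law.sets_\<mu>] by blast
qed simp

text \<open>Independence makes the joint law of all pairs a product, identical laws make it
  \<open>path_space\<close>, and a product of equal factors is invariant under dropping the first
  coordinate.\<close>

lemma distr_future: "distr M law.path_space future = law.path_space"
proof -
  have sets_path: "sets law.path_space = sets (\<Pi>\<^sub>M i\<in>UNIV. borel)"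
    by (rule sets_PiM_cong[OF refl]) (use law.sets_\<mu> in \<open>unfold borel_prod\<close>)
  have law_eq: "law = distr M borel (\<lambda>\<omega>. (\<xi> 0 \<omega>, \<eta> 0 \<omega>))"
    unfolding law_def borel_prod ..
  have rv: "(\<lambda>\<omega>. (\<xi> n \<omega>, \<eta> n \<omega>)) \<in> borel_measurable M" for n
    using measurable_pair unfolding borel_prod .
  have "distr M (\<Pi>\<^sub>M i\<in>UNIV. borel) (\<lambda>\<omega>. \<lambda>i\<in>UNIV. (\<xi> i \<omega>, \<eta> i \<omega>)) = (\<Pi>\<^sub>M i\<in>UNIV. distr M borel (\<lambda>\<omega>. (\<xi> i \<omega>, \<eta> i \<omega>)))"
    by (rule iffD1[OF indep_vars_iff_distr_eq_PiM indep]) (simp_all only: UNIV_not_empty not_False_eq_True rv)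
  also have "\<dots> = law.path_space"
    unfolding law_eq by (intro PiM_cong refl ident)
  finally have all: "distr M law.path_space (\<lambda>\<omega> i. (\<xi> i \<omega>, \<eta> i \<omega>)) = law.path_space"
    using distr_cong[OF refl sets_path, of M "\<lambda>\<omega> i. (\<xi> i \<omega>, \<eta> i \<omega>)" "\<lambda>\<omega> i. (\<xi> i \<omega>, \<eta> i \<omega>)"] by (simp add: restrict_def)
  have meas: "(\<lambda>\<omega> i. (\<xi> i \<omega>, \<eta> i \<omega>)) \<in> measurable M law.path_space"
  proof (rule measurable_PiM_single')
    show "(\<lambda>\<omega>. (\<xi> i \<omega>, \<eta> i \<omega>)) \<in> measurable M law" for i
      using measurable_pair[of i] measurable_cong_sets[OF refl law.sets_\<mu>] by blast
  qed simp
  have "law.path_space = distr law.path_space law.path_space (\<lambda>\<omega>. \<lambda>n\<in>UNIV. \<omega> (Suc n))"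
    using distr_PiM_reindex[of UNIV "\<lambda>_. law" Suc UNIV] law.prob_space_axioms by simp
  also have "\<dots> = distr (distr M law.path_space (\<lambda>\<omega> i. (\<xi> i \<omega>, \<eta> i \<omega>))) law.path_space (\<lambda>\<omega> n. \<omega> (Suc n))"
    unfolding all by (simp add: restrict_def)
  also have "\<dots> = distr M law.path_space future"
    by (subst distr_distr[OF law.measurable_shift meas]) (simp add: o_def)
  finally show ?thesis ..
qed

lemma seq_walk_future: "seq_walk n (future \<omega>) = walk \<xi> n \<omega>"
  by (simp add: seq_walk_def walk_def sum.atLeast1_atMost_eq)

lemma visits_eq: "visits \<xi> \<eta> x \<omega> = num_elems {k. seq_walk k (future \<omega>) + snd (future \<omega> k) \<le> x}"
proof -
  have "{n. 1 \<le> n \<and> pert_walk \<xi> \<eta> n \<omega> \<le> x} = Suc ` {k. seq_walk k (future \<omega>) + snd (future \<omega> k) \<le> x}"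
    unfolding seq_walk_future by (auto simp: pert_walk_def image_iff gr0_conv_Suc Suc_le_eq)
  then show ?thesis by (simp add: visits_def num_elems_Suc_image)
qed

lemma exp_moment_visits: "exp_moment M a (visits \<xi> \<eta> x) = law.full_moment x"
proof -
  have "exp_moment M a (visits \<xi> \<eta> x) = (\<integral>\<^sup>+ \<omega>. (SUP n. ennreal (exp (a * real (seq_count n x (future \<omega>))))) \<partial>M)"
    unfolding exp_moment_def visits_eq exp_num_elems[OF a_gt_0] seq_count_def ..
  also have "\<dots> = (\<integral>\<^sup>+ \<omega>. (SUP n. ennreal (exp (a * real (seq_count n x \<omega>)))) \<partial>distr M law.path_space future)"
    by (subst nn_integral_distr[OF measurable_future]) auto
  also have "\<dots> = law.full_moment x" unfolding distr_future law.full_moment_eq_path ..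
  finally show ?thesis .
qed

lemma bounded_below_future:
  assumes "AE \<omega> in M. \<exists>b. \<forall>n\<ge>1. b \<le> pert_walk \<xi> \<eta> n \<omega>"
  shows "AE \<omega> in law.path_space. \<exists>b. \<forall>n. b \<le> seq_walk n \<omega> + snd (\<omega> n)"
proof -
  \<comment> \<open>Bounds of the form -k with natural k make the event a countable union and hence
    measurable, as the transfer along \<open>distr\<close> requires.\<close>
  have "AE \<omega> in distr M law.path_space future. \<exists>k::nat. \<forall>n. - real k \<le> seq_walk n \<omega> + snd (\<omega> n)"
  proof (subst AE_distr_iff[OF measurable_future])
    show "AE \<omega> in M. \<exists>k::nat. \<forall>n. - real k \<le> seq_walk n (future \<omega>) + snd (future \<omega> n)"
      using assms
    proof eventually_elim
      case (elim \<omega>)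
      then obtain b where b: "\<And>n. n \<ge> 1 \<Longrightarrow> b \<le> pert_walk \<xi> \<eta> n \<omega>" by blast
      obtain k :: nat where k: "- b \<le> real k" using real_arch_simple by blast
      have "- real k \<le> seq_walk n (future \<omega>) + snd (future \<omega> n)" for n
        using b[of "Suc n"] k unfolding seq_walk_future by (simp add: pert_walk_def)
      then show ?case by blast
    qed
  qed measurable
  then show ?thesis unfolding distr_future by eventually_elim blast
qed

lemma nn_integral_law: "f \<in> borel_measurable (borel \<Otimes>\<^sub>M borel) \<Longrightarrow> (\<integral>\<^sup>+ z. f z \<partial>law) = (\<integral>\<^sup>+ \<omega>. f (\<xi> 0 \<omega>, \<eta> 0 \<omega>) \<partial>M)"
  unfolding law_def by (rule nn_integral_distr[OF measurable_pair]) simp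

lemma emeasure_law:
  assumes "Measurable.pred (borel \<Otimes>\<^sub>M borel) P"
  shows "emeasure law {z. P z} = emeasure M {\<omega> \<in> space M. P (\<xi> 0 \<omega>, \<eta> 0 \<omega>)}"
proof -
  have "{z. P z} \<in> sets (borel \<Otimes>\<^sub>M borel)" using law.events_Collect[OF assms] law.sets_\<mu> by simp
  then show ?thesis unfolding law_def
    by (subst emeasure_distr[OF measurable_pair]) (auto intro!: arg_cong[where f = "emeasure M"])
qed

lemma AE_law:
  assumes "Measurable.pred (borel \<Otimes>\<^sub>M borel) P"
  shows "(AE z in law. P z) \<longleftrightarrow> (AE \<omega> in M. P (\<xi> 0 \<omega>, \<eta> 0 \<omega>))"
proof -
  have "{z \<in> space (borel \<Otimes>\<^sub>M borel). P z} \<in> sets (borel \<Otimes>\<^sub>M borel)"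
    using assms unfolding pred_def .
  then show ?thesis unfolding law_def by (rule AE_distr_iff[OF measurable_pair])
qed

text \<open>Negative steps have positive probability, so minimising exponents cannot escape to
  infinity and the infimum is attained. Taking t = 0 shows that it is at most 1, which allows
  inverting \<open>neg_log\<close>.\<close>

lemma laplace_rate_ge_iff:
  assumes neg: "measure M {\<omega> \<in> space M. \<xi> 0 \<omega> < 0} > 0"
  shows "ereal a \<le> laplace_rate M (\<xi> 0)
    \<longleftrightarrow> (\<exists>\<theta>\<ge>0. (\<integral>\<^sup>+ z. ennreal (exp (- \<theta> * fst z)) \<partial>law) \<le> ennreal (exp (- a)))"
proof -
  define \<phi> where "\<phi> t = (\<integral>\<^sup>+ \<omega>. ennreal (exp (- t * \<xi> 0 \<omega>)) \<partial>M)" for t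
  have \<phi>_eq: "(\<integral>\<^sup>+ z. ennreal (exp (- t * fst z)) \<partial>law) = \<phi> t" for t
    unfolding \<phi>_def by (subst nn_integral_law) auto
  have "(INF t\<in>{0..}. \<phi> t) \<le> \<phi> 0" by (rule INF_lower) simp
  also have "\<dots> = 1" by (simp add: \<phi>_def emeasure_space_1)
  finally have "ereal a \<le> laplace_rate M (\<xi> 0) \<longleftrightarrow> (INF t\<in>{0..}. \<phi> t) \<le> ennreal (exp (- a))"
    unfolding laplace_rate_def \<phi>_def[symmetric] by (rule neg_log_ge_iff)
  also have "\<dots> \<longleftrightarrow> (\<exists>\<theta>\<ge>0. \<phi> \<theta> \<le> ennreal (exp (- a)))"
  proof
    assume le: "(INF t\<in>{0..}. \<phi> t) \<le> ennreal (exp (- a))"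
    have "\<exists>t\<ge>0. \<phi> t \<le> ennreal (exp (- a) + 1 / Suc n)" for n
    proof -
      have "ennreal (exp (- a)) < ennreal (exp (- a) + 1 / Suc n)" by (simp add: ennreal_less_iff del: ennreal_plus)
      with le have "(INF t\<in>{0..}. \<phi> t) < ennreal (exp (- a) + 1 / Suc n)" by (rule le_less_trans)
      then show ?thesis by (auto simp: INF_less_iff intro: less_imp_le)
    qed
    then obtain t where t: "\<And>n. t n \<ge> 0" "\<And>n. \<phi> (t n) \<le> ennreal (exp (- a) + 1 / Suc n)" by metis
    have "\<exists>\<theta>\<ge>0. (\<integral>\<^sup>+ \<omega>. ennreal (exp (- \<theta> * \<xi> 0 \<omega>)) \<partial>M) \<le> ennreal (exp (- a))"
    proof (rule ex_exp_integral_le[where A = "\<lambda>_. space M" and t = t])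
      show "(\<integral>\<^sup>+ \<omega>. ennreal (exp (- t n * \<xi> 0 \<omega>)) * indicator (space M) \<omega> \<partial>M) \<le> ennreal (exp (- a) + 1 / Suc n)" for n
        using t(2)[of n] unfolding \<phi>_def by (subst nn_integral_cong[of M _ "\<lambda>\<omega>. ennreal (exp (- t n * \<xi> 0 \<omega>))"]) auto
      show "emeasure M {\<omega> \<in> space M. \<xi> 0 \<omega> < 0} > 0" using neg by (simp add: emeasure_eq_measure)
    qed (auto simp: t(1) incseq_def)
    then show "\<exists>\<theta>\<ge>0. \<phi> \<theta> \<le> ennreal (exp (- a))" unfolding \<phi>_def .
  next
    assume "\<exists>\<theta>\<ge>0. \<phi> \<theta> \<le> ennreal (exp (- a))"
    then show "(INF t\<in>{0..}. \<phi> t) \<le> ennreal (exp (- a))" by (auto intro: INF_lower2)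
  qed
  finally show ?thesis unfolding \<phi>_eq .
qed

lemma law_neg:
  assumes "measure M {\<omega> \<in> space M. \<xi> 0 \<omega> < 0} > 0"
  shows "emeasure law {z. fst z < 0} > 0"
proof -
  have "Measurable.pred (borel \<Otimes>\<^sub>M borel) (\<lambda>z :: real \<times> real. fst z < 0)" by measurable
  from emeasure_law[OF this] assms show ?thesis by (simp add: emeasure_eq_measure)
qed

text \<open>Boundedness from below is asked for only under a \<le> R: for the perturbed walk it
  comes from divergence, for the unperturbed one from the drift itself.\<close>

lemma exp_moment_visits_iff:
  assumes neg: "measure M {\<omega> \<in> space M. \<xi> 0 \<omega> < 0} > 0"
    and bdd: "ereal a \<le> laplace_rate M (\<xi> 0) \<Longrightarrow> AE \<omega> in law.path_space. \<exists>b. \<forall>n. b \<le> seq_walk n \<omega> + snd (\<omega> n)"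
  shows "exp_moment M a (visits \<xi> \<eta> x) < \<infinity> \<longleftrightarrow> ereal a \<le> laplace_rate M (\<xi> 0)"
proof
  assume "exp_moment M a (visits \<xi> \<eta> x) < \<infinity>"
  then have "law.full_moment y < \<infinity>" for y
    using law.full_moment_finite_all[OF law_neg[OF neg]] by (simp add: exp_moment_visits)
  then show "ereal a \<le> laplace_rate M (\<xi> 0)"
    using law.ex_exp_drift[OF law_neg[OF neg]] by (simp add: laplace_rate_ge_iff[OF neg])
next
  assume le: "ereal a \<le> laplace_rate M (\<xi> 0)"
  then obtain \<theta> where "\<theta> \<ge> 0" "(\<integral>\<^sup>+ z. ennreal (exp (- \<theta> * fst z)) \<partial>law) \<le> ennreal (exp (- a))"
    unfolding laplace_rate_ge_iff[OF neg] by blast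
  then interpret D: exp_drift law a \<theta>
    by (intro exp_drift.intro law.step_law_axioms exp_drift_axioms.intro)
  obtain x0 where "law.full_moment x0 < \<infinity>" using D.ex_full_moment_finite_exp_drift[OF bdd[OF le]] by blast
  then show "exp_moment M a (visits \<xi> \<eta> x) < \<infinity>"
    unfolding exp_moment_visits by (rule law.full_moment_finite_all[OF law_neg[OF neg]])
qed

lemma zero_step_iff:
  "zero_step_condition M (\<xi> 0) (\<eta> 0) a x
    \<longleftrightarrow> (\<integral>\<^sup>+ z. ennreal (exp (if snd z \<le> x then a else 0)) * indicator {z. fst z = 0} z \<partial>law) < 1"
proof -
  define P where "P = {\<omega> \<in> space M. \<xi> 0 \<omega> = 0 \<and> \<eta> 0 \<omega> \<le> x}"
  define R where "R = {\<omega> \<in> space M. \<xi> 0 \<omega> = 0 \<and> \<eta> 0 \<omega> > x}"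
  have [measurable]: "P \<in> sets M" "R \<in> sets M" unfolding P_def R_def by measurable
  have ind: "(\<lambda>z :: real \<times> real. indicator {z. fst z = 0} z :: ennreal) \<in> borel_measurable (borel \<Otimes>\<^sub>M borel)"
    unfolding indicator_def mem_Collect_eq by measurable
  have "(\<lambda>z :: real \<times> real. ennreal (exp (if snd z \<le> x then a else 0)) * indicator {z. fst z = 0} z) \<in> borel_measurable (borel \<Otimes>\<^sub>M borel)"
    by (rule borel_measurable_times_ennreal[OF _ ind]) measurable
  then have "(\<integral>\<^sup>+ z. ennreal (exp (if snd z \<le> x then a else 0)) * indicator {z. fst z = 0} z \<partial>law)
      = (\<integral>\<^sup>+ \<omega>. ennreal (exp a) * indicator P \<omega> + indicator R \<omega> \<partial>M)"
    by (subst nn_integral_law) (auto intro!: nn_integral_cong simp: P_def R_def indicator_def)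
  also have "\<dots> = ennreal (exp a * measure M P + measure M R)"
    by (subst nn_integral_add) (auto simp: nn_integral_cmult_indicator emeasure_eq_measure ennreal_mult)
  finally show ?thesis
    unfolding zero_step_condition_def P_def R_def by (simp add: ennreal_less_one_iff del: ennreal_plus)
qed

lemma exp_moment_visits_nonneg_iff:
  assumes nonneg: "AE \<omega> in M. \<xi> 0 \<omega> \<ge> 0" and nondeg: "prob {\<omega> \<in> space M. \<xi> 0 \<omega> = 0} < 1"
    and bdd: "AE \<omega> in law.path_space. \<exists>b. \<forall>n. b \<le> seq_walk n \<omega> + snd (\<omega> n)"
  shows "exp_moment M a (visits \<xi> \<eta> x) < \<infinity> \<longleftrightarrow> zero_step_condition M (\<xi> 0) (\<eta> 0) a x"
proof -
  have nonneg': "AE z in law. 0 \<le> fst z" using nonneg by (subst AE_law) auto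
  have "emeasure law {z. fst z = 0} < 1"
    using nondeg by (subst emeasure_law) (auto simp: emeasure_eq_measure ennreal_less_one_iff)
  moreover obtain x0 where "law.full_moment x0 < \<infinity>" using law.ex_full_moment_finite_nonneg[OF nonneg' bdd] by blast
  ultimately show ?thesis
    unfolding exp_moment_visits zero_step_iff
    using law.full_moment_finite_nonneg[OF nonneg'] law.zero_step_less_1[OF nonneg'] by blast
qed

end

section \<open>The critical exponent as a function of the level\<close>

lemma zero_step_condition_down:
  assumes "zero_step_condition M \<xi> \<eta> b x" "c \<le> b"
  shows "zero_step_condition M \<xi> \<eta> c x"
proof -
  have "exp c * measure M {\<omega> \<in> space M. \<xi> \<omega> = 0 \<and> \<eta> \<omega> \<le> x} \<le> exp b * measure M {\<omega> \<in> space M. \<xi> \<omega> = 0 \<and> \<eta> \<omega> \<le> x}"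
    using assms(2) by (intro mult_right_mono) auto
  then show ?thesis using assms(1) by (simp add: zero_step_condition_def)
qed

text \<open>The left side is continuous in the exponent and the inequality is strict. Hence the
  supremum of the admissible exponents is not attained, and the interval is open at a(x).\<close>

lemma zero_step_condition_open:
  assumes "zero_step_condition M \<xi> \<eta> b x"
  shows "\<exists>c>b. zero_step_condition M \<xi> \<eta> c x"
proof -
  let ?f = "\<lambda>c. exp c * measure M {\<omega> \<in> space M. \<xi> \<omega> = 0 \<and> \<eta> \<omega> \<le> x} + measure M {\<omega> \<in> space M. \<xi> \<omega> = 0 \<and> \<eta> \<omega> > x}"
  have "(?f \<longlongrightarrow> ?f b) (at_right b)" by (intro tendsto_intros)
  then have "eventually (\<lambda>c. ?f c < 1) (at_right b)"
    using assms unfolding zero_step_condition_def by (rule order_tendstoD(2))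
  moreover have "eventually (\<lambda>c. c > b) (at_right b)" by (simp add: eventually_at_right_less)
  ultimately have "eventually (\<lambda>c. ?f c < 1 \<and> c > b) (at_right b)" by (rule eventually_conj)
  then show ?thesis
    unfolding zero_step_condition_def using eventually_happens trivial_limit_at_right_real by blast
qed

text \<open>In this form \<open>x\<close> enters only through P{\<xi> = 0, \<eta> \<le> x}, with a
  coefficient that is nonnegative for b \<ge> 0, so monotonicity in x and the comparison with
  P{\<xi> = 0} can be read off.\<close>

lemma (in prob_space) zero_step_condition_iff:
  assumes [measurable]: "\<xi> \<in> borel_measurable M" "\<eta> \<in> borel_measurable M"
  shows "zero_step_condition M \<xi> \<eta> b x \<longleftrightarrow>
    (exp b - 1) * prob {\<omega> \<in> space M. \<xi> \<omega> = 0 \<and> \<eta> \<omega> \<le> x} + prob {\<omega> \<in> space M. \<xi> \<omega> = 0} < 1"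
proof -
  have "prob {\<omega> \<in> space M. \<xi> \<omega> = 0}
      = prob ({\<omega> \<in> space M. \<xi> \<omega> = 0 \<and> \<eta> \<omega> \<le> x} \<union> {\<omega> \<in> space M. \<xi> \<omega> = 0 \<and> \<eta> \<omega> > x})"
    by (intro arg_cong[where f = prob]) auto
  also have "\<dots> = prob {\<omega> \<in> space M. \<xi> \<omega> = 0 \<and> \<eta> \<omega> \<le> x} + prob {\<omega> \<in> space M. \<xi> \<omega> = 0 \<and> \<eta> \<omega> > x}"
    by (intro finite_measure_Union) auto
  finally show ?thesis by (simp add: zero_step_condition_def algebra_simps)
qed

text \<open>At exponent 0 the condition reads P{\<xi> = 0} < 1; openness then yields a positive
  exponent.\<close>

lemma (in prob_space) crit_exponent_pos:
  assumes "\<xi> \<in> borel_measurable M" "\<eta> \<in> borel_measurable M" "prob {\<omega> \<in> space M. \<xi> \<omega> = 0} < 1"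
  shows "crit_exponent M \<xi> \<eta> x > 0"
proof -
  have "zero_step_condition M \<xi> \<eta> 0 x" using assms by (simp add: zero_step_condition_iff)
  then obtain c where "c > 0" "zero_step_condition M \<xi> \<eta> c x" using zero_step_condition_open by blast
  then show ?thesis unfolding crit_exponent_def
    by (intro less_SUP_iff[THEN iffD2] bexI[of _ c]) (auto simp: zero_ereal_def)
qed

lemma (in prob_space) antimono_crit_exponent:
  assumes [measurable]: "\<xi> \<in> borel_measurable M" "\<eta> \<in> borel_measurable M"
  shows "antimono (crit_exponent M \<xi> \<eta>)"
proof (rule antimonoI)
  fix x y :: real assume xy: "x \<le> y"
  have "zero_step_condition M \<xi> \<eta> b x" if b: "0 < b" "zero_step_condition M \<xi> \<eta> b y" for b
  proof -
    have "prob {\<omega> \<in> space M. \<xi> \<omega> = 0 \<and> \<eta> \<omega> \<le> x} \<le> prob {\<omega> \<in> space M. \<xi> \<omega> = 0 \<and> \<eta> \<omega> \<le> y}"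
      using xy by (intro finite_measure_mono) auto
    then have "(exp b - 1) * prob {\<omega> \<in> space M. \<xi> \<omega> = 0 \<and> \<eta> \<omega> \<le> x} \<le> (exp b - 1) * prob {\<omega> \<in> space M. \<xi> \<omega> = 0 \<and> \<eta> \<omega> \<le> y}"
      using b(1) by (intro mult_left_mono) auto
    then show ?thesis using b(2) by (simp add: zero_step_condition_iff)
  qed
  then show "crit_exponent M \<xi> \<eta> y \<le> crit_exponent M \<xi> \<eta> x"
    unfolding crit_exponent_def by (intro SUP_subset_mono) auto
qed

text \<open>Enlarging P{\<xi> = 0, \<eta> \<le> x} to P{\<xi> = 0} turns the condition into e^b
  P{\<xi> = 0} < 1, that is, b < -log P{\<xi> = 0}.\<close>

lemma (in prob_space) crit_exponent_ge:
  assumes [measurable]: "\<xi> \<in> borel_measurable M" "\<eta> \<in> borel_measurable M"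
    and nondeg: "prob {\<omega> \<in> space M. \<xi> \<omega> = 0} < 1"
  shows "neg_log (emeasure M {\<omega> \<in> space M. \<xi> \<omega> = 0}) \<le> crit_exponent M \<xi> \<eta> x"
proof (rule dense_le)
  fix c assume c: "c < neg_log (emeasure M {\<omega> \<in> space M. \<xi> \<omega> = 0})"
  show "c \<le> crit_exponent M \<xi> \<eta> x"
  proof (cases "c \<le> 0")
    case True
    then show ?thesis using crit_exponent_pos[OF assms, of x] by simp
  next
    case False
    then obtain b where b: "c = ereal b" "b > 0" using c by (cases c) (auto simp: zero_ereal_def)
    let ?t = "prob {\<omega> \<in> space M. \<xi> \<omega> = 0}"
    have "exp b * ?t < 1"
    proof (cases "?t = 0")
      case False
      then have t: "?t > 0" by (simp add: zero_less_measure_iff)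
      then have "b < - ln ?t" using c b by (simp add: neg_log_def emeasure_eq_measure)
      then have "exp b < exp (- ln ?t)" by simp
      then show ?thesis using t by (simp add: exp_minus field_simps)
    qed simp
    moreover have "(exp b - 1) * prob {\<omega> \<in> space M. \<xi> \<omega> = 0 \<and> \<eta> \<omega> \<le> x} \<le> (exp b - 1) * ?t"
      using b by (intro mult_left_mono finite_measure_mono) auto
    ultimately have "zero_step_condition M \<xi> \<eta> b x"
      by (simp add: zero_step_condition_iff algebra_simps)
    then show ?thesis unfolding crit_exponent_def b(1) using b(2) by (intro SUP_upper) simp
  qed
qed

text \<open>S_n is the walk at time n + 1 with zero perturbation; the shift matches the index ranges
  n \<ge> 0 and n \<ge> 1 of the two counts.\<close>

lemma visits_star_eq: "visits_star \<xi> x = visits \<xi> (\<lambda>_ _. 0) x"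
proof
  fix \<omega>
  have "{n. 1 \<le> n \<and> pert_walk \<xi> (\<lambda>_ _. 0) n \<omega> \<le> x} = Suc ` {n. walk \<xi> n \<omega> \<le> x}"
    by (auto simp: pert_walk_def image_iff gr0_conv_Suc Suc_le_eq)
  then show "visits_star \<xi> x \<omega> = visits \<xi> (\<lambda>_ _. 0) x \<omega>"
    by (simp add: visits_def visits_star_def num_elems_Suc_image)
qed

section \<open>The perturbed and the unperturbed walk\<close>

context perturbed_random_walk
begin

lemma iid_pairs: "a > 0 \<Longrightarrow> iid_pairs M \<xi> \<eta> a"
  by (intro iid_pairs.intro prob_space_axioms iid_pairs_axioms.intro indep_pairs ident_pairs)

lemma iid_pairs_unperturbed:
  assumes "a > 0"
  shows "iid_pairs M \<xi> (\<lambda>_ _. 0) a"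
proof (intro iid_pairs.intro prob_space_axioms iid_pairs_axioms.intro assms)
  have [measurable]: "(\<lambda>z. (fst z, 0 :: real)) \<in> measurable borel (borel :: (real \<times> real) measure)"
    by (intro borel_measurable_continuous_onI continuous_intros)
  show "indep_vars (\<lambda>_. borel) (\<lambda>n \<omega>. (\<xi> n \<omega>, 0 :: real)) UNIV"
    using indep_vars_compose2[OF indep_pairs, of "\<lambda>_ z. (fst z, 0 :: real)" "\<lambda>_. borel"] by simp
  have rv: "(\<lambda>\<omega>. (\<xi> n \<omega>, \<eta> n \<omega>)) \<in> borel_measurable M" for n
    using indep_pairs unfolding indep_vars_def by simp
  have "distr M borel (\<lambda>\<omega>. (\<xi> n \<omega>, 0 :: real))
      = distr (distr M borel (\<lambda>\<omega>. (\<xi> n \<omega>, \<eta> n \<omega>))) borel (\<lambda>z. (fst z, 0))" for n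
    by (subst distr_distr[OF _ rv]) (simp_all add: o_def)
  then show "distr M borel (\<lambda>\<omega>. (\<xi> n \<omega>, 0 :: real)) = distr M borel (\<lambda>\<omega>. (\<xi> 0 \<omega>, 0))" for n
    by (simp only: ident_pairs[of n])
qed

lemma bounded_below:
  assumes "positively_divergent M \<xi> \<eta>"
  shows "AE \<omega> in M. \<exists>b. \<forall>n\<ge>1. b \<le> pert_walk \<xi> \<eta> n \<omega>"
  using assms unfolding positively_divergent_def
proof eventually_elim
  case (elim \<omega>)
  then have "eventually (\<lambda>n. 0 \<le> pert_walk \<xi> \<eta> n \<omega>) sequentially"
    by (simp add: filterlim_at_top)
  then obtain N where N: "\<And>n. n \<ge> N \<Longrightarrow> 0 \<le> pert_walk \<xi> \<eta> n \<omega>" by (auto simp: eventually_sequentially)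
  define b where "b = Min (insert 0 ((\<lambda>n. pert_walk \<xi> \<eta> n \<omega>) ` {..<N}))"
  have "b \<le> pert_walk \<xi> \<eta> n \<omega>" for n
  proof (cases "n < N")
    case True
    then show ?thesis unfolding b_def by (intro Min_le) auto
  next
    case False
    have "b \<le> 0" unfolding b_def by (intro Min_le) auto
    then show ?thesis using N[of n] False by simp
  qed
  then show ?case by blast
qed

lemma exp_moment_visits_star_iff:
  assumes a: "a > 0" and neg: "prob {\<omega> \<in> space M. \<xi> 0 \<omega> < 0} > 0"
  shows "exp_moment M a (visits_star \<xi> x) < \<infinity> \<longleftrightarrow> ereal a \<le> laplace_rate M (\<xi> 0)"
proof -
  interpret W: iid_pairs M \<xi> "\<lambda>_ _. 0" a by (rule iid_pairs_unperturbed[OF a])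
  show ?thesis unfolding visits_star_eq
  proof (rule W.exp_moment_visits_iff[OF neg])
    assume "ereal a \<le> laplace_rate M (\<xi> 0)"
    then obtain \<theta> where "\<theta> \<ge> 0" "(\<integral>\<^sup>+ z. ennreal (exp (- \<theta> * fst z)) \<partial>W.law) \<le> ennreal (exp (- a))"
      unfolding W.laplace_rate_ge_iff[OF neg] by blast
    then interpret D: exp_drift W.law a \<theta>
      by (intro exp_drift.intro W.law.step_law_axioms exp_drift_axioms.intro)
    have "AE z in W.law. snd z = 0" by (subst W.AE_law) auto
    from W.law.AE_path[OF this] D.seq_walk_bounded_below
    show "AE \<omega> in W.law.path_space. \<exists>b. \<forall>n. b \<le> seq_walk n \<omega> + snd (\<omega> n)"
      by eventually_elim simp
  qed
qed

lemma exp_moment_visits_iff: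
  assumes a: "a > 0" and neg: "prob {\<omega> \<in> space M. \<xi> 0 \<omega> < 0} > 0" and div: "positively_divergent M \<xi> \<eta>"
  shows "exp_moment M a (visits \<xi> \<eta> x) < \<infinity> \<longleftrightarrow> ereal a \<le> laplace_rate M (\<xi> 0)"
proof -
  interpret W: iid_pairs M \<xi> \<eta> a by (rule iid_pairs[OF a])
  show ?thesis by (rule W.exp_moment_visits_iff[OF neg W.bounded_below_future[OF bounded_below[OF div]]])
qed

lemma exp_moment_visits_nonneg_iff:
  assumes a: "a > 0" and nonneg: "AE \<omega> in M. \<xi> 0 \<omega> \<ge> 0" and div: "positively_divergent M \<xi> \<eta>"
  shows "exp_moment M a (visits \<xi> \<eta> x) < \<infinity> \<longleftrightarrow> zero_step_condition M (\<xi> 0) (\<eta> 0) a x"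
proof -
  interpret W: iid_pairs M \<xi> \<eta> a by (rule iid_pairs[OF a])
  show ?thesis
    by (rule W.exp_moment_visits_nonneg_iff[OF nonneg xi_nondegenerate W.bounded_below_future[OF bounded_below[OF div]]])
qed

end

theorem theorem2p6:
  fixes M :: "'a measure" and \<xi> \<eta> :: "nat \<Rightarrow> 'a \<Rightarrow> real"
  assumes "perturbed_random_walk M \<xi> \<eta>"
    and "positively_divergent M \<xi> \<eta>"
  shows "((AE \<omega> in M. \<xi> 0 \<omega> \<ge> 0) \<longrightarrow>
      (\<forall>a>0. \<forall>x. exp_moment M a (visits \<xi> \<eta> x) < \<infinity> \<longleftrightarrow> zero_step_condition M (\<xi> 0) (\<eta> 0) a x) \<and>
      (\<forall>x. ereal ` {a. a > 0 \<and> exp_moment M a (visits \<xi> \<eta> x) < \<infinity>}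
             = {0<..<crit_exponent M (\<xi> 0) (\<eta> 0) x}) \<and>
      (\<forall>x. crit_exponent M (\<xi> 0) (\<eta> 0) x > 0) \<and>
      antimono (crit_exponent M (\<xi> 0) (\<eta> 0)) \<and>
      (\<forall>x. crit_exponent M (\<xi> 0) (\<eta> 0) x \<ge> neg_log (emeasure M {\<omega> \<in> space M. \<xi> 0 \<omega> = 0})))
    \<and> ((AE \<omega> in M. \<xi> 0 \<omega> > 0) \<longrightarrow>
      (\<forall>x. crit_exponent M (\<xi> 0) (\<eta> 0) x = \<infinity>) \<and>
      (\<forall>a>0. \<forall>x. exp_moment M a (visits \<xi> \<eta> x) < \<infinity>))
    \<and> (measure M {\<omega> \<in> space M. \<xi> 0 \<omega> < 0} > 0 \<longrightarrow>
      (\<forall>a>0.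
        ((\<exists>x. exp_moment M a (visits \<xi> \<eta> x) < \<infinity>) \<longleftrightarrow> laplace_rate M (\<xi> 0) \<ge> ereal a) \<and>
        ((\<forall>x. exp_moment M a (visits \<xi> \<eta> x) < \<infinity>) \<longleftrightarrow> laplace_rate M (\<xi> 0) \<ge> ereal a) \<and>
        ((\<exists>x. exp_moment M a (visits_star \<xi> x) < \<infinity>) \<longleftrightarrow> laplace_rate M (\<xi> 0) \<ge> ereal a) \<and>
        ((\<forall>x. exp_moment M a (visits_star \<xi> x) < \<infinity>) \<longleftrightarrow> laplace_rate M (\<xi> 0) \<ge> ereal a)))"
proof -
  interpret perturbed_random_walk M \<xi> \<eta> by (rule assms(1))
  note div = assms(2)
  have meas: "\<xi> 0 \<in> borel_measurable M" "\<eta> 0 \<in> borel_measurable M"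
    using iid_pairs.measurable_\<xi>[OF iid_pairs[of 1]] iid_pairs.measurable_\<eta>[OF iid_pairs[of 1]] by simp_all
  let ?ac = "crit_exponent M (\<xi> 0) (\<eta> 0)" and ?Z = "zero_step_condition M (\<xi> 0) (\<eta> 0)"
  have iff: "exp_moment M a (visits \<xi> \<eta> x) < \<infinity> \<longleftrightarrow> ?Z a x" if "a > 0" "AE \<omega> in M. \<xi> 0 \<omega> \<ge> 0" for a x
    using exp_moment_visits_nonneg_iff[OF that div] .
  have ge: "neg_log (emeasure M {\<omega> \<in> space M. \<xi> 0 \<omega> = 0}) \<le> ?ac x" for x
    by (rule crit_exponent_ge[OF meas xi_nondegenerate])
  have interval: "ereal ` {a. a > 0 \<and> exp_moment M a (visits \<xi> \<eta> x) < \<infinity>} = {0<..<?ac x}"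
    if "AE \<omega> in M. \<xi> 0 \<omega> \<ge> 0" for x
  proof -
    have eq: "{a. a > 0 \<and> exp_moment M a (visits \<xi> \<eta> x) < \<infinity>} = {a. 0 < a \<and> ?Z a x}"
      using iff that by blast
    show ?thesis unfolding eq crit_exponent_def
    proof (rule ereal_image_eq_greaterThanLessThan)
      fix b assume b: "b \<in> {a. 0 < a \<and> ?Z a x}"
      then obtain c where "b < c" "?Z c x" using zero_step_condition_open by blast
      moreover from this b have "0 < c" by simp
      ultimately show "\<exists>c\<in>{a. 0 < a \<and> ?Z a x}. b < c" by blast
      show "c \<in> {a. 0 < a \<and> ?Z a x}" if "0 < c" "c < b" for c
        using b that zero_step_condition_down[of M "\<xi> 0" "\<eta> 0" b x c] by simp
    qed simp
  qed
  \<comment> \<open>The atom of \<xi> at 0 vanishes, so the lower bound for the critical exponent is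
    -log 0 = \<infinity>, and the interval of finite moments is (0, \<infinity>).\<close>
  have part_b: "?ac x = \<infinity> \<and> (\<forall>a>0. exp_moment M a (visits \<xi> \<eta> x) < \<infinity>)" if pos: "AE \<omega> in M. \<xi> 0 \<omega> > 0" for x
  proof -
    have nonneg: "AE \<omega> in M. \<xi> 0 \<omega> \<ge> 0" using pos by eventually_elim simp
    have "AE \<omega> in M. \<not> \<xi> 0 \<omega> = 0" using pos by eventually_elim simp
    then have "emeasure M {\<omega> \<in> space M. \<xi> 0 \<omega> = 0} = 0"
      using meas by (subst (asm) AE_iff_measurable[OF _ refl]) auto
    then have "?ac x = \<infinity>" using ge[of x] by (simp add: neg_log_def)
    moreover have "exp_moment M a (visits \<xi> \<eta> x) < \<infinity>" if a: "a > 0" for a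
    proof -
      have "ereal a \<in> ereal ` {a. a > 0 \<and> exp_moment M a (visits \<xi> \<eta> x) < \<infinity>}"
        unfolding interval[OF nonneg] using \<open>?ac x = \<infinity>\<close> a by simp
      then show ?thesis by auto
    qed
    ultimately show ?thesis by blast
  qed
  \<comment> \<open>In the third part each equivalence holds at every single x with a right side
    free of x, so the versions for some x and for all x follow alike.\<close>
  show ?thesis
    using iff interval crit_exponent_pos[OF meas xi_nondegenerate] antimono_crit_exponent[OF meas] ge part_b
      exp_moment_visits_iff[OF _ _ div] exp_moment_visits_star_iff
    by auto
qed

end
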